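(* Let $\Phi,\Psi\in{\bf PFm}$ be modal formulas of ${\rm FP}(Ł,Ł)$ and let $\mathcal{E}=\{\varphi_1,\dots,\varphi_k\}$ be the set of event formulas occurring in them (as arguments of $P$). Then the following are equivalent: (1) $\Phi\vdash_{FP}\Psi$; (2) $\chi_{\mathcal{E}},\Phi^\bullet\vdash_{Ł}\Psi^\bullet$; (3) $\mathscr{C}_{\mathcal{E}}\cap\mathcal{M}od(\Phi^\bullet)\subseteq\mathcal{M}od(\Psi^\bullet)$; (4) the quasiequation "if $\chi_{\mathcal{E}}\approx\top$ and $\Phi^\bullet\approx\top$ then $\Psi^\bullet\approx\top$" holds in all MV-algebras.
   Context: Łukasiewicz logic Ł: formulas are built from propositional variables using $\oplus,\neg,\bot$, with abbreviations $\top=\neg\bot$, $\varphi\to\psi=\neg\varphi\oplus\psi$, $\varphi\odot\psi=\neg(\neg\varphi\oplus\neg\psi)$, $\varphi\vee\psi=(\varphi\to\psi)\to\psi$, $\varphi\wedge\psi=\neg(\neg\varphi\vee\neg\psi)$, $\varphi\leftrightarrow\psi=(\varphi\to\psi)\wedge(\psi\to\varphi)$. Its axioms are $\varphi\to(\psi\to\varphi)$, $(\varphi\to\psi)\to((\psi\to\gamma)\to(\varphi\to\gamma))$, $((\varphi\to\psi)\to\psi)\to((\psi\to\varphi)\to\varphi)$, $(\neg\varphi\to\neg\psi)\to(\psi\to\varphi)$, with modus ponens; $\vdash_Ł$ is its derivability relation. The standard MV-algebra is $[0,1]_{MV}=([0,1],\oplus,\neg,0)$ with $x\oplus y=\min(1,x+y)$,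 $\neg x=1-x$; for a Łukasiewicz formula $\varphi$ in variables $x_1,\dots,x_n$, $f_\varphi:[0,1]^n\to[0,1]$ is its truth function (McNaughton function) in $[0,1]_{MV}$. The logic ${\rm FP}(Ł,Ł)$: event formulas are Łukasiewicz formulas; modal formulas are built from atomic modal formulas $P(\varphi)$ ($\varphi$ an event formula) and the constants $\top,\bot$ using the Łukasiewicz connectives, so each modal formula has the form $t[P(\varphi_1),\dots,P(\varphi_k)]$ for a Łukasiewicz term $t$; ${\bf PFm}$ is the set of modal formulas. Axioms and rules: all axioms and rules of Ł for event formulas; all axioms and rules of Ł for modal formulas; (P1) $\neg P(\varphi)\leftrightarrow P(\neg\varphi)$; (P2) $P(\varphi\to\psi)\to(P(\varphi)\to P(\psi))$; (P3) $P(\varphi\oplus\psi)\leftrightarrow[(P(\varphi)\to P(\varphi\odot\psi))\to P(\psi)]$; (N) from $\varphi$ derive $P(\varphi)$. $\Gamma\vdash_{FP}\Phi$ denotes derivability. Coherent set: for a set of events $\mathcal{E}=\{\varphi_1,\dots,\varphi_k\}$ in variables $x_1,\dots,x_n$, $\mathscr{C}_{\mathcal{E}}\subseteq[0,1]^k$ is the closed convex hull of $\{(f_{\varphi_1}(x),\dots,f_{\varphi_k}(x)) : x\in[0,1]^n\}$ (a rational polytope). Translation $^\bullet$: to each atomic modal formula $P(\varphi)$ associate a fresh propositional variable $p_\varphi$; set $\bot^\bullet=\bot$, $\top^\bullet=\top$, $P(\varphi)^\bullet=p_\varphi$ and $(t[P(\varphi_1),\dots,P(\varphi_k)])^\bullet=t[p_{\varphi_1},\dots,p_{\varphi_k}]$.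 Points of $[0,1]^k$ are identified with assignments of values to $p_{\varphi_1},\dots,p_{\varphi_k}$, and for a Łukasiewicz formula $\gamma$ in these variables $\mathcal{M}od(\gamma)\subseteq[0,1]^k$ is the set of assignments giving $\gamma$ value $1$ in $[0,1]_{MV}$. $\chi_{\mathcal{E}}$ denotes a (fixed, algorithmically obtained) Łukasiewicz formula in the variables $p_{\varphi_1},\dots,p_{\varphi_k}$ with $\mathcal{M}od(\chi_{\mathcal{E}})=\mathscr{C}_{\mathcal{E}}$.
   Formalization: With ⊕, ¬, ⊥ primitive the four listed axioms do not derive ⊤, so the equivalence fails; ⊤, (φ⊕ψ)→(¬φ→ψ) and (¬φ→ψ)→(φ⊕ψ) are added as axioms for event and modal formulas. In (4) MV-algebras have carriers in an arbitrary infinite type, covering all up to isomorphism. *)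

theory Defs
  imports "HOL-Analysis.Analysis" "HOL-Library.Function_Algebras"
begin

section \<open>Formulas and derivability in Lukasiewicz logic\<close>

datatype (vars: 'v) luk =
    Var 'v
  | Bot ("\<^bold>\<bottom>")
  | Neg "'v luk" ("\<^bold>\<not> _" [90] 90)
  | Oplus "'v luk" "'v luk" (infixr "\<^bold>\<oplus>" 75)

abbreviation Top :: "'v luk" ("\<^bold>\<top>")
  where "\<^bold>\<top> \<equiv> \<^bold>\<not> \<^bold>\<bottom>"

abbreviation Imp :: "'v luk \<Rightarrow> 'v luk \<Rightarrow> 'v luk" (infixr "\<^bold>\<rightarrow>" 55)
  where "a \<^bold>\<rightarrow> b \<equiv> \<^bold>\<not> a \<^bold>\<oplus> b"

abbreviation Odot :: "'v luk \<Rightarrow> 'v luk \<Rightarrow> 'v luk" (infixr "\<^bold>\<odot>" 80)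
  where "a \<^bold>\<odot> b \<equiv> \<^bold>\<not> (\<^bold>\<not> a \<^bold>\<oplus> \<^bold>\<not> b)"

text \<open>
  The first four schemata are Lukasiewicz's axioms, which are complete for the language with
  implication and negation primitive and the remaining connectives defined from them.  Here
  \<open>\<^bold>\<oplus>\<close>, \<open>\<^bold>\<not>\<close> and \<open>\<^bold>\<bottom>\<close> are primitive, and the four schemata alone
  say nothing about \<open>\<^bold>\<bottom>\<close> or about \<open>a \<^bold>\<oplus> b\<close> when \<open>a\<close> is not a negation
  (\<open>a \<^bold>\<oplus> b\<close> could be treated as a new variable).  The last three schemata state the
  defining equivalences of these two connectives: \<open>\<^bold>\<bottom>\<close> is the negation of a theorem and
  \<open>a \<^bold>\<oplus> b\<close> is \<open>\<^bold>\<not> a \<^bold>\<rightarrow> b\<close>.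
\<close>

inductive luk_deriv :: "'v luk set \<Rightarrow> 'v luk \<Rightarrow> bool" (infix "\<turnstile>\<^sub>L" 50)
  for \<Gamma> :: "'v luk set" where
  prem: "a \<in> \<Gamma> \<Longrightarrow> \<Gamma> \<turnstile>\<^sub>L a"
| L1: "\<Gamma> \<turnstile>\<^sub>L a \<^bold>\<rightarrow> (b \<^bold>\<rightarrow> a)"
| L2: "\<Gamma> \<turnstile>\<^sub>L (a \<^bold>\<rightarrow> b) \<^bold>\<rightarrow> ((b \<^bold>\<rightarrow> c) \<^bold>\<rightarrow> (a \<^bold>\<rightarrow> c))"
| L3: "\<Gamma> \<turnstile>\<^sub>L ((a \<^bold>\<rightarrow> b) \<^bold>\<rightarrow> b) \<^bold>\<rightarrow> ((b \<^bold>\<rightarrow> a) \<^bold>\<rightarrow> a)"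
| L4: "\<Gamma> \<turnstile>\<^sub>L (\<^bold>\<not> a \<^bold>\<rightarrow> \<^bold>\<not> b) \<^bold>\<rightarrow> (b \<^bold>\<rightarrow> a)"
| top: "\<Gamma> \<turnstile>\<^sub>L \<^bold>\<top>"
| oplus_imp: "\<Gamma> \<turnstile>\<^sub>L (a \<^bold>\<oplus> b) \<^bold>\<rightarrow> (\<^bold>\<not> a \<^bold>\<rightarrow> b)"
| imp_oplus: "\<Gamma> \<turnstile>\<^sub>L (\<^bold>\<not> a \<^bold>\<rightarrow> b) \<^bold>\<rightarrow> (a \<^bold>\<oplus> b)"
| mp: "\<Gamma> \<turnstile>\<^sub>L a \<Longrightarrow> \<Gamma> \<turnstile>\<^sub>L a \<^bold>\<rightarrow> b \<Longrightarrow> \<Gamma> \<turnstile>\<^sub>L b"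

section \<open>The probabilistic logic\<close>

text \<open>Event formulas are of type \<open>'v luk\<close>.\<close>

datatype 'v modal =
    Pr "'v luk"
  | MBot ("\<^bold>\<bottom>\<^sub>m")
  | MNeg "'v modal" ("\<^bold>\<not>\<^sub>m _" [90] 90)
  | MOplus "'v modal" "'v modal" (infixr "\<^bold>\<oplus>\<^sub>m" 75)

abbreviation MTop :: "'v modal" ("\<^bold>\<top>\<^sub>m")
  where "\<^bold>\<top>\<^sub>m \<equiv> \<^bold>\<not>\<^sub>m \<^bold>\<bottom>\<^sub>m"

abbreviation MImp :: "'v modal \<Rightarrow> 'v modal \<Rightarrow> 'v modal" (infixr "\<^bold>\<rightarrow>\<^sub>m" 55)
  where "A \<^bold>\<rightarrow>\<^sub>m B \<equiv> \<^bold>\<not>\<^sub>m A \<^bold>\<oplus>\<^sub>m B"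

abbreviation MOr :: "'v modal \<Rightarrow> 'v modal \<Rightarrow> 'v modal" (infixr "\<^bold>\<or>\<^sub>m" 60)
  where "A \<^bold>\<or>\<^sub>m B \<equiv> (A \<^bold>\<rightarrow>\<^sub>m B) \<^bold>\<rightarrow>\<^sub>m B"

abbreviation MAnd :: "'v modal \<Rightarrow> 'v modal \<Rightarrow> 'v modal" (infixr "\<^bold>\<and>\<^sub>m" 65)
  where "A \<^bold>\<and>\<^sub>m B \<equiv> \<^bold>\<not>\<^sub>m (\<^bold>\<not>\<^sub>m A \<^bold>\<or>\<^sub>m \<^bold>\<not>\<^sub>m B)"

abbreviation MIff :: "'v modal \<Rightarrow> 'v modal \<Rightarrow> 'v modal" (infix "\<^bold>\<leftrightarrow>\<^sub>m" 53)
  where "A \<^bold>\<leftrightarrow>\<^sub>m B \<equiv> (A \<^bold>\<rightarrow>\<^sub>m B) \<^bold>\<and>\<^sub>m (B \<^bold>\<rightarrow>\<^sub>m A)"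

primrec events :: "'v modal \<Rightarrow> 'v luk set" where
  "events (Pr a) = {a}"
| "events \<^bold>\<bottom>\<^sub>m = {}"
| "events (\<^bold>\<not>\<^sub>m A) = events A"
| "events (A \<^bold>\<oplus>\<^sub>m B) = events A \<union> events B"

text \<open>
  The premises are modal formulas, so the event formulas occurring in a derivation are exactly
  the theorems of Lukasiewicz logic; hence the premise of the necessitation rule \<open>N\<close>.
\<close>

inductive fp_deriv :: "'v modal set \<Rightarrow> 'v modal \<Rightarrow> bool" (infix "\<turnstile>\<^sub>F\<^sub>P" 50)
  for \<Gamma> :: "'v modal set" where
  prem: "A \<in> \<Gamma> \<Longrightarrow> \<Gamma> \<turnstile>\<^sub>F\<^sub>P A"
| L1: "\<Gamma> \<turnstile>\<^sub>F\<^sub>P A \<^bold>\<rightarrow>\<^sub>m (B \<^bold>\<rightarrow>\<^sub>m A)"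
| L2: "\<Gamma> \<turnstile>\<^sub>F\<^sub>P (A \<^bold>\<rightarrow>\<^sub>m B) \<^bold>\<rightarrow>\<^sub>m ((B \<^bold>\<rightarrow>\<^sub>m C) \<^bold>\<rightarrow>\<^sub>m (A \<^bold>\<rightarrow>\<^sub>m C))"
| L3: "\<Gamma> \<turnstile>\<^sub>F\<^sub>P ((A \<^bold>\<rightarrow>\<^sub>m B) \<^bold>\<rightarrow>\<^sub>m B) \<^bold>\<rightarrow>\<^sub>m ((B \<^bold>\<rightarrow>\<^sub>m A) \<^bold>\<rightarrow>\<^sub>m A)"
| L4: "\<Gamma> \<turnstile>\<^sub>F\<^sub>P (\<^bold>\<not>\<^sub>m A \<^bold>\<rightarrow>\<^sub>m \<^bold>\<not>\<^sub>m B) \<^bold>\<rightarrow>\<^sub>m (B \<^bold>\<rightarrow>\<^sub>m A)"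
| top: "\<Gamma> \<turnstile>\<^sub>F\<^sub>P \<^bold>\<top>\<^sub>m"
| oplus_imp: "\<Gamma> \<turnstile>\<^sub>F\<^sub>P (A \<^bold>\<oplus>\<^sub>m B) \<^bold>\<rightarrow>\<^sub>m (\<^bold>\<not>\<^sub>m A \<^bold>\<rightarrow>\<^sub>m B)"
| imp_oplus: "\<Gamma> \<turnstile>\<^sub>F\<^sub>P (\<^bold>\<not>\<^sub>m A \<^bold>\<rightarrow>\<^sub>m B) \<^bold>\<rightarrow>\<^sub>m (A \<^bold>\<oplus>\<^sub>m B)"
| mp: "\<Gamma> \<turnstile>\<^sub>F\<^sub>P A \<Longrightarrow> \<Gamma> \<turnstile>\<^sub>F\<^sub>P A \<^bold>\<rightarrow>\<^sub>m B \<Longrightarrow> \<Gamma> \<turnstile>\<^sub>F\<^sub>P B"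
| P1: "\<Gamma> \<turnstile>\<^sub>F\<^sub>P \<^bold>\<not>\<^sub>m Pr a \<^bold>\<leftrightarrow>\<^sub>m Pr (\<^bold>\<not> a)"
| P2: "\<Gamma> \<turnstile>\<^sub>F\<^sub>P Pr (a \<^bold>\<rightarrow> b) \<^bold>\<rightarrow>\<^sub>m (Pr a \<^bold>\<rightarrow>\<^sub>m Pr b)"
| P3: "\<Gamma> \<turnstile>\<^sub>F\<^sub>P Pr (a \<^bold>\<oplus> b) \<^bold>\<leftrightarrow>\<^sub>m ((Pr a \<^bold>\<rightarrow>\<^sub>m Pr (a \<^bold>\<odot> b)) \<^bold>\<rightarrow>\<^sub>m Pr b)"
| N: "{} \<turnstile>\<^sub>L a \<Longrightarrow> \<Gamma> \<turnstile>\<^sub>F\<^sub>P Pr a"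

text \<open>The propositional variable \<open>p\<^sub>a\<close> is \<open>Var a\<close>, a variable of the
  propositional language over the variable type \<open>'v luk\<close>.\<close>

primrec bullet :: "'v modal \<Rightarrow> 'v luk luk" ("_\<^sup>\<bullet>" [1000] 999) where
  "(Pr a)\<^sup>\<bullet> = Var a"
| "(\<^bold>\<bottom>\<^sub>m)\<^sup>\<bullet> = \<^bold>\<bottom>"
| "(\<^bold>\<not>\<^sub>m A)\<^sup>\<bullet> = \<^bold>\<not> (A\<^sup>\<bullet>)"
| "(A \<^bold>\<oplus>\<^sub>m B)\<^sup>\<bullet> = A\<^sup>\<bullet> \<^bold>\<oplus> B\<^sup>\<bullet>"

section \<open>MV-algebras and truth functions\<close>

text \<open>Carriers are sets, so that a formula can quantify over MV-algebras.  With the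
  element type \<open>'a\<close> ranging over the infinite types, this covers every MV-algebra up to isomorphism; over a
  finite type \<open>'a\<close> it would cover only finite algebras of bounded size.\<close>

locale mv_algebra =
  fixes M :: "'a set" and add :: "'a \<Rightarrow> 'a \<Rightarrow> 'a" and neg :: "'a \<Rightarrow> 'a" and zero :: 'a
  assumes zero_closed: "zero \<in> M"
    and neg_closed: "x \<in> M \<Longrightarrow> neg x \<in> M"
    and add_closed: "x \<in> M \<Longrightarrow> y \<in> M \<Longrightarrow> add x y \<in> M"
    and add_assoc: "x \<in> M \<Longrightarrow> y \<in> M \<Longrightarrow> z \<in> M \<Longrightarrow> add (add x y) z = add x (add y z)"
    and add_comm: "x \<in> M \<Longrightarrow> y \<in> M \<Longrightarrow> add x y = add y x"
    and add_zero: "x \<in> M \<Longrightarrow> add x zero = x"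
    and neg_neg: "x \<in> M \<Longrightarrow> neg (neg x) = x"
    and add_neg_zero: "x \<in> M \<Longrightarrow> add x (neg zero) = neg zero"
    and mv: "x \<in> M \<Longrightarrow> y \<in> M \<Longrightarrow>
      add (neg (add (neg x) y)) y = add (neg (add (neg y) x)) x"

primrec mv_eval ::
    "('a \<Rightarrow> 'a \<Rightarrow> 'a) \<Rightarrow> ('a \<Rightarrow> 'a) \<Rightarrow> 'a \<Rightarrow> ('v \<Rightarrow> 'a) \<Rightarrow> 'v luk \<Rightarrow> 'a" where
  "mv_eval add neg zero v (Var p) = v p"
| "mv_eval add neg zero v \<^bold>\<bottom> = zero"
| "mv_eval add neg zero v (\<^bold>\<not> a) = neg (mv_eval add neg zero v a)"
| "mv_eval add neg zero v (a \<^bold>\<oplus> b) = add (mv_eval add neg zero v a) (mv_eval add neg zero v b)"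

definition std_add :: "real \<Rightarrow> real \<Rightarrow> real" where
  "std_add x y = min 1 (x + y)"

definition std_neg :: "real \<Rightarrow> real" where
  "std_neg x = 1 - x"

lemma mv_algebra_std: "mv_algebra {0..1} std_add std_neg 0"
  by standard (auto simp: std_add_def std_neg_def min_def)

text \<open>\<open>truth v a\<close> is the value at \<open>v\<close> of the McNaughton function of \<open>a\<close>; it depends
  only on \<open>v\<close> restricted to \<open>vars a\<close>.\<close>

definition truth :: "('v \<Rightarrow> real) \<Rightarrow> 'v luk \<Rightarrow> real" where
  "truth = mv_eval std_add std_neg 0"

section \<open>The coherent set and models\<close>

text \<open>
  For a finite set \<open>E\<close> of events, the space of real vectors with coordinates indexed by \<open>E\<close>
  is identified with the functions on \<open>'v luk\<close> that vanish outside \<open>E\<close>.  With pointwise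
  operations and the product topology (the topology of pointwise convergence), convex hulls and
  closures of sets of such functions coincide with those in the finite-dimensional space.
\<close>

instantiation "fun" :: (type, real_vector) real_vector
begin

definition scaleR_fun :: "real \<Rightarrow> ('a \<Rightarrow> 'b) \<Rightarrow> 'a \<Rightarrow> 'b" where
  "scaleR_fun r f = (\<lambda>x. r *\<^sub>R f x)"

instance
  by standard (simp_all add: scaleR_fun_def fun_eq_iff scaleR_add_right scaleR_add_left)

end

definition coherent :: "'v luk set \<Rightarrow> ('v luk \<Rightarrow> real) set" where
  "coherent E = closure (convex hull
     {(\<lambda>a. if a \<in> E then truth x a else 0) | x :: 'v \<Rightarrow> real. range x \<subseteq> {0..1}})"

definition cube :: "'p set \<Rightarrow> ('p \<Rightarrow> real) set" where
  "cube E = {v. (\<forall>p\<in>E. v p \<in> {0..1}) \<and> (\<forall>p. p \<notin> E \<longrightarrow> v p = 0)}"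

text \<open>\<open>Models E c\<close> is meant for formulas \<open>c\<close> with variables in \<open>E\<close>.\<close>

definition Models :: "'p set \<Rightarrow> 'p luk \<Rightarrow> ('p \<Rightarrow> real) set" where
  "Models E c = {v \<in> cube E. truth v c = 1}"

end

theory Submission
  imports Defs "HOL-Algebra.FiniteProduct" "HOL-Library.Countable"
begin

text \<open>
  Finite strong completeness of Lukasiewicz logic: the Lindenbaum algebra of a prime theory is an
  MV-chain, which is the unit interval of Chang's ordered abelian group. A refuting valuation in the
  chain solves a finite system of integer linear inequalities over that group, and Fourier-Motzkin
  elimination, which uses only sums of the given inequalities, moves solvability to the reals.

  Completeness of the probabilistic logic: by elimination again, the coherent set is cut out by
  finitely many integer inequalities, because it is convex and a finite union of rational
  polytopes. Each of them is forced by finitely many axioms: an integer bound on a sum of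
  McNaughton functions says that the first members of the corresponding good sequence are theorems,
  and (P3) makes probabilities additive along the formation of good sequences. Soundness holds
  because coherent assignments extend to states, by compactness of the set of all states.
\<close>

section \<open>MV-algebras\<close>

text \<open>The obstacle is (3) to (1). After translation the axioms of the probabilistic logic are
  infinitely many premises, and Lukasiewicz logic is complete over [0,1] only for finitely many. So
  it is not enough that all axioms together force an assignment to be coherent: for the given events
  finitely many of them must do so, which calls for a finite description of the coherent set. That
  description is not derived from the McNaughton functions; it is read off from \<open>chi\<close>
  and the convexity of the coherent set. Integer coefficients matter twice: an ordered abelian group
  has integer multiples only, and a coefficient n of P(a) becomes n copies of a in a list of events.
  Conversely, a derivation may involve events outside the given set, so a coherent assignment must
  be extended to all events before soundness applies. In (4) the element type is merely infinite and
  may be too small to hold [0,1]; a real counterexample lives on countably many reals, and these can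
  be copied.\<close>

context mv_algebra
begin

abbreviation "mone \<equiv> neg zero"
abbreviation "imp x y \<equiv> add (neg x) y"
abbreviation "od x y \<equiv> neg (add (neg x) (neg y))"

lemmas closed = zero_closed neg_closed add_closed

lemma zero_add: "x \<in> M \<Longrightarrow> add zero x = x"
  by (metis add_comm add_zero zero_closed)

lemma one_add: "x \<in> M \<Longrightarrow> add mone x = mone"
  by (metis add_comm add_neg_zero zero_closed neg_closed)

lemma add_left_comm: "x \<in> M \<Longrightarrow> y \<in> M \<Longrightarrow> z \<in> M \<Longrightarrow> add x (add y z) = add y (add x z)"
  by (metis add_assoc add_comm)

lemma imp_one: "x \<in> M \<Longrightarrow> imp mone x = x"
  by (simp add: neg_neg zero_closed zero_add)

text \<open>The instance y = 1 of the axiom \<open>mv\<close>, whose left side collapses to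
  1.\<close>

lemma imp_self: "x \<in> M \<Longrightarrow> imp x x = mone"
  using mv[of x mone] by (simp add: closed neg_neg zero_closed zero_add add_neg_zero)

lemma add_neg_self: "x \<in> M \<Longrightarrow> add x (neg x) = mone"
  by (metis imp_self add_comm neg_closed)

lemma neg_eq_one: "x \<in> M \<Longrightarrow> neg x = mone \<longleftrightarrow> x = zero"
  by (metis neg_neg zero_closed)

lemma imp_antisym: "x \<in> M \<Longrightarrow> y \<in> M \<Longrightarrow> imp x y = mone \<Longrightarrow> imp y x = mone \<Longrightarrow> x = y"
  using mv[of x y] imp_one by metis

lemma contrapos: "x \<in> M \<Longrightarrow> y \<in> M \<Longrightarrow> imp (neg x) (neg y) = imp y x"
  by (simp add: neg_neg neg_closed add_comm)

lemma imp_weaken: "x \<in> M \<Longrightarrow> y \<in> M \<Longrightarrow> imp x (imp y x) = mone"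
  by (simp add: add_left_comm[of "neg x"] closed imp_self add_neg_zero)

text \<open>The axiom \<open>mv\<close> exchanges (y -> z) -> z for (z -> y) -> y. This turns (y ->
  z) -> (x -> z) into (z -> y) -> (x -> y), and the claim becomes weakening.\<close>

lemma imp_trans_eq:
  assumes "x \<in> M" "y \<in> M" "z \<in> M"
  shows "imp (imp x y) (imp (imp y z) (imp x z)) = mone"
proof -
  have "imp (imp y z) (imp x z) = imp x (imp (imp y z) z)"
    using assms by (intro add_left_comm) (auto intro: closed)
  also have "\<dots> = imp x (imp (imp z y) y)"
    using assms mv by metis
  also have "\<dots> = imp (imp z y) (imp x y)"
    using assms by (intro add_left_comm) (auto intro: closed)
  finally show ?thesis
    using assms by (simp add: imp_weaken closed)
qed

text \<open>In other words, the join of x -> y and y -> x is 1. With s the join of x and y, these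
  are s -> y and s -> x. Contraposition and exchange expose the join of \<not>y and \<not>s, which
  is \<not>y, so (x -> y) -> (y -> x) reduces to y -> x.\<close>

lemma prelinear:
  assumes "x \<in> M" "y \<in> M"
  shows "imp (imp (imp x y) (imp y x)) (imp y x) = mone"
proof -
  define s where "s = imp (imp x y) y"
  have s: "s \<in> M" using assms by (simp add: s_def closed)
  have xs: "imp x s = mone"
    unfolding s_def using assms by (simp add: add_left_comm[of "neg x"] closed imp_self)
  have ys: "imp y s = mone"
    unfolding s_def using assms by (simp add: imp_weaken closed)
  have join: "imp (imp s z) z = s" if "z \<in> M" "imp z s = mone" for z
    using mv[of s z] that s by (simp add: imp_one closed)
  have 1: "imp x y = imp s y"
  proof (rule imp_antisym)
    show "imp (imp x y) (imp s y) = mone"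
      using assms by (simp add: s_def add_left_comm[of "neg (imp x y)"] closed imp_self)
    have "imp (imp x s) (imp (imp s y) (imp x y)) = mone"
      using assms s by (rule_tac imp_trans_eq)
    then show "imp (imp s y) (imp x y) = mone"
      using assms s xs by (simp add: imp_one closed)
  qed (use assms s in \<open>auto intro: closed\<close>)
  have 2: "imp y x = imp s x"
  proof (rule imp_antisym)
    have "s = imp (imp y x) x" using assms mv s_def by simp
    then show "imp (imp y x) (imp s x) = mone"
      using assms by (simp add: add_left_comm[of "neg (imp y x)"] closed imp_self)
    have "imp (imp y s) (imp (imp s x) (imp y x)) = mone"
      using assms s by (rule_tac imp_trans_eq)
    then show "imp (imp s x) (imp y x) = mone"
      using assms s ys by (simp add: imp_one closed)
  qed (use assms s in \<open>auto intro: closed\<close>)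
  have "imp (imp x y) (imp y x) = imp (imp (neg y) (neg s)) (imp (neg x) (neg s))"
    unfolding 1 2 using assms s by (simp add: contrapos)
  also have "\<dots> = imp (neg x) (imp (imp (neg y) (neg s)) (neg s))"
    using assms s by (intro add_left_comm) (auto intro: closed)
  also have "\<dots> = imp (neg x) (imp (imp (neg s) (neg y)) (neg y))"
    using assms s mv[of "neg y" "neg s"] by (simp add: closed)
  also have "\<dots> = imp (neg x) (neg y)"
    using assms s contrapos[of s y] by (simp only: ys imp_one closed)
  also have "\<dots> = imp y x"
    using assms by (simp add: contrapos)
  finally show ?thesis
    using assms by (simp add: imp_self closed)
qed

lemma mv_eval_closed: "range v \<subseteq> M \<Longrightarrow> mv_eval add neg zero v a \<in> M"
  by (induction a) (auto intro: closed)

lemma luk_sound: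
  assumes "\<Gamma> \<turnstile>\<^sub>L a" and v: "range v \<subseteq> M"
    and "\<And>c. c \<in> \<Gamma> \<Longrightarrow> mv_eval add neg zero v c = mone"
  shows "mv_eval add neg zero v a = mone"
  using assms(1)
proof induction
  case (L1 a b)
  then show ?case using v by (simp add: imp_weaken mv_eval_closed)
next
  case (L2 a b c)
  then show ?case using v by (simp add: imp_trans_eq mv_eval_closed)
next
  case (L3 a b)
  show ?case
    using mv_eval_closed[OF v, of a] mv_eval_closed[OF v, of b]
    by (simp add: mv[of "mv_eval add neg zero v a"] imp_self closed)
next
  case (L4 a b)
  show ?case
    using mv_eval_closed[OF v, of a] mv_eval_closed[OF v, of b]
    by (simp add: contrapos imp_self closed)
next
  case (oplus_imp a b)
  then show ?case using v by (simp add: mv_eval_closed neg_neg imp_self closed)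
next
  case (imp_oplus a b)
  then show ?case using v by (simp add: mv_eval_closed neg_neg imp_self closed)
next
  case (mp a b)
  then show ?case using v by (simp add: imp_one mv_eval_closed)
qed (use assms in auto)

text \<open>The hypothesis says a \<odot> b = 0, so nothing is cut off in a \<oplus> b; the left
  side is the truncated difference of a \<oplus> b and a.\<close>

lemma cancel:
  assumes "a \<in> M" "b \<in> M" "add (neg a) (neg b) = mone"
  shows "od (add a b) (neg a) = b"
proof -
  have "add (neg (add a b)) a = neg b"
    using mv[of "neg b" a] assms
    by (simp add: neg_neg closed add_comm[of "neg b"] add_comm[of b a] zero_add neg_neg zero_closed)
  then show ?thesis using assms by (simp add: neg_neg)
qed

end

section \<open>Totally ordered MV-algebras and Chang's ordered abelian group\<close>

locale mv_chain = mv_algebra +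
  assumes total: "x \<in> M \<Longrightarrow> y \<in> M \<Longrightarrow> add (neg x) y = neg zero \<or> add (neg y) x = neg zero"
    and nontrivial: "zero \<noteq> neg zero"
begin

text \<open>By totality b \<le> \<not>a or \<not>a \<le> b, and the latter means a \<oplus> b = 1.
  So a sum in a chain either overflows or is exact.\<close>

lemma add_neg_eq_one:
  assumes "a \<in> M" "b \<in> M" "add a b \<noteq> mone"
  shows "add (neg a) (neg b) = mone"
proof -
  have "imp b (neg a) = mone"
    using total[of b "neg a"] assms by (simp add: neg_neg closed)
  then show ?thesis using assms by (simp add: add_comm closed)
qed

text \<open>Chang's enveloping group: \<open>(n, a)\<close> stands for \<open>n \<cdot> 1 + a\<close>, with \<open>a \<noteq> 1\<close>,
  so that the unit is \<open>(1, zero)\<close>.\<close>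

definition gadd :: "int \<times> 'a \<Rightarrow> int \<times> 'a \<Rightarrow> int \<times> 'a" where
  "gadd x y = (if add (snd x) (snd y) = mone then (fst x + fst y + 1, od (snd x) (snd y))
    else (fst x + fst y, add (snd x) (snd y)))"

definition chang_group :: "(int \<times> 'a) monoid" where
  "chang_group = \<lparr>carrier = UNIV \<times> (M - {mone}), mult = gadd, one = (0, zero)\<rparr>"

text \<open>The positive cone: since 0 \<le> a < 1 in a pair (n, a), the sign is decided by n. The
  order of the group enters only through this set.\<close>

definition nonneg :: "(int \<times> 'a) set" where
  "nonneg = {0..} \<times> (M - {mone})"

lemma od_comm: "a \<in> M \<Longrightarrow> b \<in> M \<Longrightarrow> od a b = od b a"
  by (simp add: closed add_comm)

lemma add_eq_zero: "a \<in> M \<Longrightarrow> b \<in> M \<Longrightarrow> add a b = zero \<Longrightarrow> a = zero"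
  using add_assoc[of "neg a" a b] neg_neg[of a] neg_neg[OF zero_closed]
  by (simp add: imp_self one_add add_zero closed)

lemma od_eq_one: "a \<in> M \<Longrightarrow> b \<in> M \<Longrightarrow> od a b = mone \<Longrightarrow> a = mone"
  using add_eq_zero[of "neg a" "neg b"] by (metis add_closed neg_closed neg_neg zero_closed)

text \<open>When a + b and b + c do not exceed 1, both sides are a + b + c - 1 cut off at 0. The
  auxiliary d is the complement of b + c, so the complement of c splits as b \<oplus> d and b can be
  cancelled. This serves associativity when neither neighbouring pair overflows.\<close>

lemma od_add:
  assumes "a \<in> M" "b \<in> M" "c \<in> M" "add (neg a) (neg b) = mone" "add (neg b) (neg c) = mone"
  shows "od (add a b) c = od a (add b c)"
proof -
  define d where "d = neg (add c b)"
  have d: "d \<in> M" using assms by (simp add: d_def closed)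
  have "add b d = neg c"
    using mv[of "neg c" b] assms
    by (simp add: d_def closed neg_neg add_comm[of b] zero_add zero_closed)
  then have c: "c = neg (add b d)"
    using assms neg_neg by metis
  have "add (neg (add a b)) b = neg a"
    using cancel[of b a] assms neg_neg closed add_comm by metis
  then have "add (neg (add a b)) (add b d) = add (neg a) d"
    using assms d add_assoc[of "neg (add a b)" b d] by (simp add: closed)
  then have "od (add a b) c = neg (add (neg a) d)"
    using assms d by (simp add: c neg_neg closed)
  then show ?thesis
    using assms by (simp add: d_def add_comm)
qed

lemma add_mono_right:
  assumes "x \<in> M" "y \<in> M" "e \<in> M" "imp x y = mone"
  shows "imp (add e x) (add e y) = mone"
proof -
  have "imp (imp (neg e) x) (imp (imp x y) (imp (neg e) y)) = mone"
    using assms by (intro imp_trans_eq) (auto intro: closed)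
  then show ?thesis
    using assms by (simp add: neg_neg zero_add closed)
qed

text \<open>Here a + b overflows and b + c does not, so both sides are a + b + c - 1, with e = a + b
  - 1. The bound by a guarantees that this sum stays different from 1 whenever a does, so no second
  carry arises.\<close>

lemma od_add':
  assumes "a \<in> M" "b \<in> M" "c \<in> M" "add a b = mone" "add (neg b) (neg c) = mone"
  shows "add (od a b) c = od a (add b c)" "imp (add (od a b) c) a = mone"
proof -
  define e where "e = od a b"
  have e: "e \<in> M" using assms by (simp add: e_def closed)
  have b: "b = add (neg a) e"
    using mv[of b "neg a"] assms
    by (simp add: e_def closed neg_neg add_comm zero_add add_zero)
  have ea: "imp e a = mone"
    using assms by (simp add: e_def neg_neg closed add_comm[of _ "neg b"] add_assoc imp_self add_neg_zero)
  have "add e (neg b) = a"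
    using mv[of a e] assms e ea
    by (simp add: b closed neg_neg add_comm[of e] zero_add zero_closed)
  moreover have "imp c (neg b) = mone"
    using assms by (simp add: add_comm closed)
  ultimately show "imp (add (od a b) c) a = mone"
    using add_mono_right[of c "neg b" e] assms e by (simp add: e_def closed)
  then have "od (add (neg a) (add e c)) a = add e c"
    using cancel[of "neg a" "add e c"] assms e
    by (simp add: e_def neg_neg closed add_comm[of a])
  moreover have "od a (add b c) = od (add (neg a) (add e c)) a"
    using assms e by (simp add: b add_assoc closed od_comm[of a])
  ultimately show "add (od a b) c = od a (add b c)"
    by (simp add: e_def)
qed

text \<open>The case of two overflows, obtained from \<open>od_add\<close> by De Morgan
  duality.\<close>

lemma add_od:
  assumes "a \<in> M" "b \<in> M" "c \<in> M" "add a b = mone" "add b c = mone"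
  shows "add (od a b) c = add a (od b c)"
  using od_add[of "neg a" "neg b" "neg c"] assms by (simp add: closed neg_neg) (metis neg_neg closed)

lemma od_assoc: "a \<in> M \<Longrightarrow> b \<in> M \<Longrightarrow> c \<in> M \<Longrightarrow> od (od a b) c = od a (od b c)"
  by (simp add: closed neg_neg add_assoc)

lemma gadd_comm:
  "snd x \<in> M \<Longrightarrow> snd y \<in> M \<Longrightarrow> gadd x y = gadd y x"
  by (simp add: gadd_def add_comm[of "snd y" "snd x"] od_comm[of "snd y" "snd x"]
      add.commute[of "fst y" "fst x"])

lemma gadd_closed:
  "x \<in> UNIV \<times> (M - {mone}) \<Longrightarrow> y \<in> UNIV \<times> (M - {mone}) \<Longrightarrow> gadd x y \<in> UNIV \<times> (M - {mone})"
  using od_eq_one[of "snd x" "snd y"] by (cases x; cases y) (auto simp: gadd_def closed)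

lemma gadd_assoc:
  assumes "x \<in> UNIV \<times> (M - {mone})" "y \<in> UNIV \<times> (M - {mone})" "z \<in> UNIV \<times> (M - {mone})"
  shows "gadd (gadd x y) z = gadd x (gadd y z)"
proof -
  obtain n a m b k c where [simp]: "x = (n, a)" "y = (m, b)" "z = (k, c)"
    by (metis surj_pair)
  have M: "a \<in> M" "b \<in> M" "c \<in> M" and ne: "a \<noteq> mone" "b \<noteq> mone" "c \<noteq> mone"
    using assms by auto
  have le_ne: "x \<noteq> mone" if "imp x y = mone" "y \<noteq> mone" "y \<in> M" for x y
    using that imp_one by auto
  consider "add a b \<noteq> mone" "add b c \<noteq> mone" | "add a b = mone" "add b c \<noteq> mone"
    | "add a b \<noteq> mone" "add b c = mone" | "add a b = mone" "add b c = mone"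
    by blast
  then show ?thesis
  proof cases
    case 1
    then have "od (add a b) c = od a (add b c)"
      using M by (intro od_add add_neg_eq_one) auto
    then show ?thesis using 1 M by (auto simp: gadd_def add_assoc)
  next
    case 2
    have *: "add (od a b) c = od a (add b c)" "imp (add (od a b) c) a = mone"
      using 2 M add_neg_eq_one by (auto intro: od_add')
    moreover have "add a (add b c) = mone"
      using 2 M by (metis add_assoc one_add)
    ultimately show ?thesis using 2 M ne le_ne[OF *(2)] by (auto simp: gadd_def)
  next
    \<comment> \<open>The mirror image of the previous case, with the triple read from right to
      left.\<close>
    case 3
    have *: "add (od c b) a = od c (add b a)" "imp (add (od c b) a) c = mone"
      using od_add'[of c b a] add_neg_eq_one[of b a] 3 M
      by (simp_all add: add_comm[of c b] add_comm[of b a])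
    then have "add a (od b c) = od (add a b) c"
      using M by (simp add: add_comm closed)
    moreover have "add a (od b c) \<noteq> mone"
      using M ne le_ne[OF *(2)] by (simp add: add_comm closed)
    moreover have "add (add a b) c = mone"
      using 3 M by (metis add_assoc add_neg_zero)
    ultimately show ?thesis using 3 M by (auto simp: gadd_def)
  next
    case 4
    then have "add (od a b) c = add a (od b c)"
      using M by (intro add_od) auto
    moreover have "od (od a b) c = od a (od b c)"
      using M by (rule od_assoc)
    ultimately show ?thesis using 4 by (simp add: gadd_def)
  qed
qed

lemma comm_group_chang: "comm_group chang_group"
proof (rule comm_groupI)
  fix x assume x: "x \<in> carrier chang_group"
  obtain n a where na: "x = (n, a)" by force
  have a: "a \<in> M" "a \<noteq> mone" using x na by (auto simp: chang_group_def)
  \<comment> \<open>The inverse of n + a is (-n - 1) + (1 - a). For a = 0 the second part would be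
    the excluded value 1, hence the separate form.\<close>
  have "\<exists>y \<in> UNIV \<times> (M - {mone}). gadd y x = (0, zero)"
    using a nontrivial
    by (intro bexI[of _ "if a = zero then (- n, zero) else (- n - 1, neg a)"])
      (auto simp: gadd_def na imp_self neg_neg closed add_zero neg_eq_one add_neg_self zero_closed)
  then show "\<exists>y \<in> carrier chang_group. y \<otimes>\<^bsub>chang_group\<^esub> x = \<one>\<^bsub>chang_group\<^esub>"
    by (simp add: chang_group_def)
next
  fix x y assume "x \<in> carrier chang_group" "y \<in> carrier chang_group"
  then show "x \<otimes>\<^bsub>chang_group\<^esub> y = y \<otimes>\<^bsub>chang_group\<^esub> x"
    by (auto simp: chang_group_def gadd_comm)
qed (use nontrivial in \<open>auto simp: chang_group_def gadd_assoc gadd_closed zero_closed zero_add gadd_def[of "(0, zero)"]\<close>)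

lemma nonneg_closed: "x \<in> nonneg \<Longrightarrow> y \<in> nonneg \<Longrightarrow> gadd x y \<in> nonneg"
  using gadd_closed[of x y] by (auto simp: nonneg_def gadd_def split: if_splits)

text \<open>Antisymmetry of the order; it later excludes negative multiples of a positive element
  from the cone.\<close>

lemma nonneg_add_eq_zero:
  assumes "x \<in> nonneg" "y \<in> nonneg" "gadd x y = (0, zero)"
  shows "x = (0, zero)"
  using assms add_eq_zero[of "snd x" "snd y"]
  by (cases x; cases y) (auto simp: nonneg_def gadd_def split: if_splits)

definition emb :: "'a \<Rightarrow> int \<times> 'a" where
  "emb a = (if a = mone then (1, zero) else (0, a))"

lemma emb_nonneg: "a \<in> M \<Longrightarrow> emb a \<in> nonneg"
  using nontrivial by (auto simp: emb_def nonneg_def zero_closed)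

lemma emb_neg: "a \<in> M \<Longrightarrow> gadd (emb a) (emb (neg a)) = (1, zero)"
  using nontrivial
  by (auto simp: emb_def gadd_def neg_neg neg_eq_one add_neg_self imp_self zero_closed neg_closed zero_add add_zero)

lemma emb_add:
  assumes "a \<in> M" "b \<in> M" "add (neg a) (neg b) = mone"
  shows "emb (add a b) = gadd (emb a) (emb b)"
proof -
  consider "a = mone" | "b = mone" | "a \<noteq> mone" "b \<noteq> mone" by blast
  then show ?thesis
  proof cases
    case 1
    then have "b = zero" using assms
      by (metis neg_neg zero_add zero_closed neg_closed)
    then show ?thesis using nontrivial 1 by (simp add: emb_def gadd_def add_zero zero_add zero_closed neg_closed)
  next
    case 2
    then have "a = zero" using assms
      by (metis neg_neg add_zero zero_closed neg_closed)
    then show ?thesis using nontrivial 2 by (simp add: emb_def gadd_def zero_add add_zero zero_closed neg_closed)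
  next
    case 3
    then show ?thesis using assms by (simp add: emb_def gadd_def neg_neg zero_closed)
  qed
qed

text \<open>A sum that overflows is 1 + (a \<odot> b): in the group it exceeds the unit by an
  element of M, which makes the inequality for a cut-off disjunction valid there.\<close>

lemma emb_add_overflow:
  assumes "a \<in> M" "b \<in> M" "add a b = mone"
  shows "gadd (emb a) (emb b) = gadd (1, zero) (emb (od a b))"
proof -
  have "od a b \<noteq> mone" if "a \<noteq> mone"
    using that assms od_eq_one by blast
  then show ?thesis using assms nontrivial
    by (auto simp: emb_def gadd_def neg_neg zero_closed closed zero_add add_zero)
qed

end

section \<open>The Lindenbaum algebra\<close>

lemma luk_syll: "\<Gamma> \<turnstile>\<^sub>L a \<^bold>\<rightarrow> b \<Longrightarrow> \<Gamma> \<turnstile>\<^sub>L b \<^bold>\<rightarrow> c \<Longrightarrow> \<Gamma> \<turnstile>\<^sub>L a \<^bold>\<rightarrow> c"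
  by (blast intro: luk_deriv.mp luk_deriv.L2)

text \<open>\<open>L1\<close> in the form a -> ((b -> a) -> a), after which \<open>L3\<close>
  exchanges the roles of a and b.\<close>

lemma luk_assert: "\<Gamma> \<turnstile>\<^sub>L a \<^bold>\<rightarrow> ((a \<^bold>\<rightarrow> b) \<^bold>\<rightarrow> b)"
  by (rule luk_syll[OF luk_deriv.L1 luk_deriv.L3])

lemma luk_exchange: "\<Gamma> \<turnstile>\<^sub>L (a \<^bold>\<rightarrow> (b \<^bold>\<rightarrow> c)) \<^bold>\<rightarrow> (b \<^bold>\<rightarrow> (a \<^bold>\<rightarrow> c))"
  by (rule luk_syll[OF luk_deriv.L2]) (rule luk_deriv.mp[OF luk_assert luk_deriv.L2])

lemma luk_exch: "\<Gamma> \<turnstile>\<^sub>L a \<^bold>\<rightarrow> (b \<^bold>\<rightarrow> c) \<Longrightarrow> \<Gamma> \<turnstile>\<^sub>L b \<^bold>\<rightarrow> (a \<^bold>\<rightarrow> c)"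
  by (rule luk_deriv.mp[OF _ luk_exchange])

lemma luk_self: "\<Gamma> \<turnstile>\<^sub>L a \<^bold>\<rightarrow> a"
  by (rule luk_deriv.mp[OF luk_deriv.top luk_exch[OF luk_deriv.L1]])

lemma luk_weaken: "\<Gamma> \<turnstile>\<^sub>L a \<Longrightarrow> \<Gamma> \<turnstile>\<^sub>L b \<^bold>\<rightarrow> a"
  by (rule luk_deriv.mp[OF _ luk_deriv.L1])

lemma luk_prefix: "\<Gamma> \<turnstile>\<^sub>L b \<^bold>\<rightarrow> c \<Longrightarrow> \<Gamma> \<turnstile>\<^sub>L (a \<^bold>\<rightarrow> b) \<^bold>\<rightarrow> (a \<^bold>\<rightarrow> c)"
  by (rule luk_deriv.mp[OF _ luk_exch[OF luk_deriv.L2]])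

lemma luk_suffix: "\<Gamma> \<turnstile>\<^sub>L a \<^bold>\<rightarrow> b \<Longrightarrow> \<Gamma> \<turnstile>\<^sub>L (b \<^bold>\<rightarrow> c) \<^bold>\<rightarrow> (a \<^bold>\<rightarrow> c)"
  by (rule luk_deriv.mp[OF _ luk_deriv.L2])

lemma luk_double_neg: "\<Gamma> \<turnstile>\<^sub>L \<^bold>\<not> \<^bold>\<not> a \<^bold>\<rightarrow> a"
proof -
  \<comment> \<open>Start from \<not>\<not>a -> (\<not>\<not>\<top> -> \<not>\<not>a), an instance
    of \<open>L1\<close>; two uses of \<open>L4\<close> strip the negations.\<close>
  have "\<Gamma> \<turnstile>\<^sub>L \<^bold>\<not> \<^bold>\<not> a \<^bold>\<rightarrow> (\<^bold>\<top> \<^bold>\<rightarrow> a)"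
    by (rule luk_syll[OF luk_syll[OF luk_deriv.L1 luk_deriv.L4] luk_deriv.L4])
  then show ?thesis
    by (rule luk_deriv.mp[OF luk_deriv.top luk_exch])
qed

lemma luk_neg_double: "\<Gamma> \<turnstile>\<^sub>L a \<^bold>\<rightarrow> \<^bold>\<not> \<^bold>\<not> a"
  by (rule luk_deriv.mp[OF luk_double_neg luk_deriv.L4])

lemma luk_contrapos: "\<Gamma> \<turnstile>\<^sub>L a \<^bold>\<rightarrow> b \<Longrightarrow> \<Gamma> \<turnstile>\<^sub>L \<^bold>\<not> b \<^bold>\<rightarrow> \<^bold>\<not> a"
  by (rule luk_deriv.mp[OF luk_syll[OF luk_double_neg luk_syll[OF _ luk_neg_double]] luk_deriv.L4])

lemma luk_oplus_mono:
  assumes "\<Gamma> \<turnstile>\<^sub>L a \<^bold>\<rightarrow> a'" "\<Gamma> \<turnstile>\<^sub>L b \<^bold>\<rightarrow> b'"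
  shows "\<Gamma> \<turnstile>\<^sub>L (a \<^bold>\<oplus> b) \<^bold>\<rightarrow> (a' \<^bold>\<oplus> b')"
  by (rule luk_syll[OF luk_deriv.oplus_imp luk_syll[OF luk_suffix[OF luk_contrapos[OF assms(1)]]
        luk_syll[OF luk_prefix[OF assms(2)] luk_deriv.imp_oplus]]])

lemma luk_oplus_comm: "\<Gamma> \<turnstile>\<^sub>L (a \<^bold>\<oplus> b) \<^bold>\<rightarrow> (b \<^bold>\<oplus> a)"
proof -
  have "\<Gamma> \<turnstile>\<^sub>L (\<^bold>\<not> a \<^bold>\<rightarrow> b) \<^bold>\<rightarrow> (\<^bold>\<not> a \<^bold>\<rightarrow> \<^bold>\<not> \<^bold>\<not> b)"
    by (rule luk_prefix[OF luk_neg_double])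
  then show ?thesis
    by (meson luk_syll luk_deriv.oplus_imp luk_deriv.imp_oplus luk_deriv.L4)
qed

lemma luk_oplus_left_comm: "\<Gamma> \<turnstile>\<^sub>L (a \<^bold>\<oplus> (b \<^bold>\<oplus> c)) \<^bold>\<rightarrow> (b \<^bold>\<oplus> (a \<^bold>\<oplus> c))"
  by (rule luk_syll[OF luk_deriv.oplus_imp luk_syll[OF luk_prefix[OF luk_deriv.oplus_imp]
        luk_syll[OF luk_exchange luk_syll[OF luk_prefix[OF luk_deriv.imp_oplus] luk_deriv.imp_oplus]]]])

lemma luk_oplus_assoc:
  "\<Gamma> \<turnstile>\<^sub>L ((a \<^bold>\<oplus> b) \<^bold>\<oplus> c) \<^bold>\<rightarrow> (a \<^bold>\<oplus> (b \<^bold>\<oplus> c))"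
  "\<Gamma> \<turnstile>\<^sub>L (a \<^bold>\<oplus> (b \<^bold>\<oplus> c)) \<^bold>\<rightarrow> ((a \<^bold>\<oplus> b) \<^bold>\<oplus> c)"
proof -
  have *: "\<Gamma> \<turnstile>\<^sub>L (a \<^bold>\<oplus> (c \<^bold>\<oplus> b)) \<^bold>\<rightarrow> (a \<^bold>\<oplus> (b \<^bold>\<oplus> c))" for b c
    by (rule luk_oplus_mono[OF luk_self luk_oplus_comm])
  show "\<Gamma> \<turnstile>\<^sub>L ((a \<^bold>\<oplus> b) \<^bold>\<oplus> c) \<^bold>\<rightarrow> (a \<^bold>\<oplus> (b \<^bold>\<oplus> c))"
    by (rule luk_syll[OF luk_oplus_comm luk_syll[OF luk_oplus_left_comm *]])
  show "\<Gamma> \<turnstile>\<^sub>L (a \<^bold>\<oplus> (b \<^bold>\<oplus> c)) \<^bold>\<rightarrow> ((a \<^bold>\<oplus> b) \<^bold>\<oplus> c)"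
    by (rule luk_syll[OF * luk_syll[OF luk_oplus_left_comm luk_oplus_comm]])
qed

lemma luk_oplus_bot: "\<Gamma> \<turnstile>\<^sub>L (a \<^bold>\<oplus> \<^bold>\<bottom>) \<^bold>\<rightarrow> a" "\<Gamma> \<turnstile>\<^sub>L a \<^bold>\<rightarrow> (a \<^bold>\<oplus> \<^bold>\<bottom>)"
proof -
  have "\<Gamma> \<turnstile>\<^sub>L (\<^bold>\<not> a \<^bold>\<rightarrow> \<^bold>\<not> \<^bold>\<top>) \<^bold>\<rightarrow> (\<^bold>\<top> \<^bold>\<rightarrow> a)"
    by (rule luk_deriv.L4)
  then have "\<Gamma> \<turnstile>\<^sub>L (a \<^bold>\<oplus> \<^bold>\<bottom>) \<^bold>\<rightarrow> (\<^bold>\<top> \<^bold>\<rightarrow> a)"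
    by (meson luk_syll luk_deriv.oplus_imp luk_prefix luk_neg_double)
  then show "\<Gamma> \<turnstile>\<^sub>L (a \<^bold>\<oplus> \<^bold>\<bottom>) \<^bold>\<rightarrow> a"
    by (rule luk_deriv.mp[OF luk_deriv.top luk_exch])
  show "\<Gamma> \<turnstile>\<^sub>L a \<^bold>\<rightarrow> (a \<^bold>\<oplus> \<^bold>\<bottom>)"
    by (rule luk_syll[OF _ luk_oplus_comm])
      (rule luk_syll[OF luk_deriv.L1 luk_deriv.imp_oplus])
qed

text \<open>One chosen representative for each class of formulas equivalent over \<Gamma>: the
  Lindenbaum algebra then has formulas as elements, and \<Gamma> stays a parameter. Equivalent
  formulas get the same representative because they define the same predicate for the
  choice.\<close>

definition nf :: "'v luk set \<Rightarrow> 'v luk \<Rightarrow> 'v luk" where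
  "nf \<Gamma> a = (SOME b. \<Gamma> \<turnstile>\<^sub>L a \<^bold>\<rightarrow> b \<and> \<Gamma> \<turnstile>\<^sub>L b \<^bold>\<rightarrow> a)"

lemma nf_equiv: "\<Gamma> \<turnstile>\<^sub>L a \<^bold>\<rightarrow> nf \<Gamma> a" "\<Gamma> \<turnstile>\<^sub>L nf \<Gamma> a \<^bold>\<rightarrow> a"
proof -
  have "\<exists>b. \<Gamma> \<turnstile>\<^sub>L a \<^bold>\<rightarrow> b \<and> \<Gamma> \<turnstile>\<^sub>L b \<^bold>\<rightarrow> a" by (blast intro: luk_self)
  then have "\<Gamma> \<turnstile>\<^sub>L a \<^bold>\<rightarrow> nf \<Gamma> a \<and> \<Gamma> \<turnstile>\<^sub>L nf \<Gamma> a \<^bold>\<rightarrow> a"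
    unfolding nf_def by (rule someI_ex)
  then show "\<Gamma> \<turnstile>\<^sub>L a \<^bold>\<rightarrow> nf \<Gamma> a" "\<Gamma> \<turnstile>\<^sub>L nf \<Gamma> a \<^bold>\<rightarrow> a" by auto
qed

lemma nf_eq_iff: "nf \<Gamma> a = nf \<Gamma> b \<longleftrightarrow> \<Gamma> \<turnstile>\<^sub>L a \<^bold>\<rightarrow> b \<and> \<Gamma> \<turnstile>\<^sub>L b \<^bold>\<rightarrow> a"
proof
  assume "nf \<Gamma> a = nf \<Gamma> b"
  then show "\<Gamma> \<turnstile>\<^sub>L a \<^bold>\<rightarrow> b \<and> \<Gamma> \<turnstile>\<^sub>L b \<^bold>\<rightarrow> a"
    by (metis nf_equiv luk_syll)
next
  assume "\<Gamma> \<turnstile>\<^sub>L a \<^bold>\<rightarrow> b \<and> \<Gamma> \<turnstile>\<^sub>L b \<^bold>\<rightarrow> a"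
  then have "(\<Gamma> \<turnstile>\<^sub>L a \<^bold>\<rightarrow> c \<and> \<Gamma> \<turnstile>\<^sub>L c \<^bold>\<rightarrow> a) \<longleftrightarrow> (\<Gamma> \<turnstile>\<^sub>L b \<^bold>\<rightarrow> c \<and> \<Gamma> \<turnstile>\<^sub>L c \<^bold>\<rightarrow> b)" for c
    by (meson luk_syll)
  then show "nf \<Gamma> a = nf \<Gamma> b" by (simp add: nf_def)
qed

lemma nf_neg: "nf \<Gamma> (\<^bold>\<not> nf \<Gamma> a) = nf \<Gamma> (\<^bold>\<not> a)"
  by (simp add: nf_eq_iff nf_equiv luk_contrapos)

lemma nf_oplus: "nf \<Gamma> (nf \<Gamma> a \<^bold>\<oplus> b) = nf \<Gamma> (a \<^bold>\<oplus> b)" "nf \<Gamma> (a \<^bold>\<oplus> nf \<Gamma> b) = nf \<Gamma> (a \<^bold>\<oplus> b)"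
  by (simp_all add: nf_eq_iff nf_equiv luk_oplus_mono luk_self)

lemma nf_top_iff: "nf \<Gamma> a = nf \<Gamma> \<^bold>\<top> \<longleftrightarrow> \<Gamma> \<turnstile>\<^sub>L a"
  unfolding nf_eq_iff by (meson luk_weaken luk_deriv.mp luk_deriv.top)

abbreviation "nf_add \<Gamma> \<equiv> \<lambda>x y. nf \<Gamma> (x \<^bold>\<oplus> y)"
abbreviation "nf_neg \<Gamma> \<equiv> \<lambda>x. nf \<Gamma> (\<^bold>\<not> x)"

lemma mv_algebra_lindenbaum: "mv_algebra (range (nf \<Gamma>)) (nf_add \<Gamma>) (nf_neg \<Gamma>) (nf \<Gamma> \<^bold>\<bottom>)"
proof
  fix x y assume "x \<in> range (nf \<Gamma>)" "y \<in> range (nf \<Gamma>)"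
  then obtain a b where [simp]: "x = nf \<Gamma> a" "y = nf \<Gamma> b" by auto
  show "nf \<Gamma> (nf \<Gamma> (\<^bold>\<not> nf \<Gamma> (nf \<Gamma> (\<^bold>\<not> x) \<^bold>\<oplus> y)) \<^bold>\<oplus> y) =
    nf \<Gamma> (nf \<Gamma> (\<^bold>\<not> nf \<Gamma> (nf \<Gamma> (\<^bold>\<not> y) \<^bold>\<oplus> x)) \<^bold>\<oplus> x)"
    by (simp only: nf_oplus nf_neg) (simp add: nf_eq_iff luk_deriv.L3)
  show "nf \<Gamma> (x \<^bold>\<oplus> y) = nf \<Gamma> (y \<^bold>\<oplus> x)"
    by (simp add: nf_eq_iff luk_oplus_comm)
next
  fix x y z assume "x \<in> range (nf \<Gamma>)" "y \<in> range (nf \<Gamma>)" "z \<in> range (nf \<Gamma>)"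
  show "nf \<Gamma> (nf \<Gamma> (x \<^bold>\<oplus> y) \<^bold>\<oplus> z) = nf \<Gamma> (x \<^bold>\<oplus> nf \<Gamma> (y \<^bold>\<oplus> z))"
    by (simp add: nf_oplus) (simp add: nf_eq_iff luk_oplus_assoc)
next
  fix x assume "x \<in> range (nf \<Gamma>)"
  then obtain a where [simp]: "x = nf \<Gamma> a" by auto
  show "nf \<Gamma> (x \<^bold>\<oplus> nf \<Gamma> \<^bold>\<bottom>) = x"
    by (simp add: nf_oplus) (simp add: nf_eq_iff luk_oplus_bot)
  show "nf \<Gamma> (\<^bold>\<not> nf \<Gamma> (\<^bold>\<not> x)) = x"
    by (simp add: nf_neg) (simp add: nf_eq_iff luk_double_neg luk_neg_double nf_equiv
        luk_syll[OF luk_double_neg] luk_syll[OF _ luk_neg_double])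
  have "\<Gamma> \<turnstile>\<^sub>L a \<^bold>\<oplus> \<^bold>\<top>"
    by (rule luk_deriv.mp[OF luk_weaken[OF luk_deriv.top] luk_deriv.imp_oplus])
  then have "nf \<Gamma> (a \<^bold>\<oplus> \<^bold>\<top>) = nf \<Gamma> \<^bold>\<top>" by (simp add: nf_top_iff)
  then show "nf \<Gamma> (x \<^bold>\<oplus> nf \<Gamma> (\<^bold>\<not> nf \<Gamma> \<^bold>\<bottom>)) = nf \<Gamma> (\<^bold>\<not> nf \<Gamma> \<^bold>\<bottom>)"
    by (simp add: nf_oplus nf_neg)
qed auto

section \<open>Prime theories\<close>

lemma luk_mono: "\<Gamma> \<turnstile>\<^sub>L a \<Longrightarrow> \<Gamma> \<subseteq> \<Delta> \<Longrightarrow> \<Delta> \<turnstile>\<^sub>L a"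
  by (induction rule: luk_deriv.induct) (auto intro: luk_deriv.intros)

lemma luk_finite: "\<Gamma> \<turnstile>\<^sub>L a \<Longrightarrow> \<exists>\<Delta>. finite \<Delta> \<and> \<Delta> \<subseteq> \<Gamma> \<and> \<Delta> \<turnstile>\<^sub>L a"
proof (induction rule: luk_deriv.induct)
  case (prem a)
  then show ?case by (intro exI[of _ "{a}"]) (auto intro: luk_deriv.prem)
next
  case (mp a b)
  then obtain \<Delta> \<Delta>' where "finite \<Delta>" "\<Delta> \<subseteq> \<Gamma>" "\<Delta> \<turnstile>\<^sub>L a" "finite \<Delta>'" "\<Delta>' \<subseteq> \<Gamma>" "\<Delta>' \<turnstile>\<^sub>L a \<^bold>\<rightarrow> b"
    by blast
  then show ?case
    by (intro exI[of _ "\<Delta> \<union> \<Delta>'"])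
      (auto intro: luk_deriv.mp[of _ a] luk_mono)
qed (rule exI[of _ "{}"], simp add: luk_deriv.intros)+

section \<open>The local deduction theorem and proof by cases\<close>

abbreviation imp_pow :: "nat \<Rightarrow> 'v luk \<Rightarrow> 'v luk \<Rightarrow> 'v luk" where
  "imp_pow n a \<equiv> (\<lambda>b. a \<^bold>\<rightarrow> b) ^^ n"

lemma imp_pow_weaken: "\<Gamma> \<turnstile>\<^sub>L b \<^bold>\<rightarrow> imp_pow n a b"
proof (induction n)
  case (Suc n)
  then show ?case by (simp add: luk_syll[OF _ luk_deriv.L1])
qed (simp add: luk_self)

lemma imp_pow_mono: "\<Gamma> \<turnstile>\<^sub>L b \<^bold>\<rightarrow> c \<Longrightarrow> \<Gamma> \<turnstile>\<^sub>L imp_pow n a b \<^bold>\<rightarrow> imp_pow n a c"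
  by (induction n) (simp_all add: luk_prefix)

lemma imp_pow_exch: "\<Gamma> \<turnstile>\<^sub>L imp_pow n a (b \<^bold>\<rightarrow> c) \<Longrightarrow> \<Gamma> \<turnstile>\<^sub>L b \<^bold>\<rightarrow> imp_pow n a c"
proof (induction n arbitrary: c)
  case (Suc n)
  then have "\<Gamma> \<turnstile>\<^sub>L imp_pow n a (a \<^bold>\<rightarrow> (b \<^bold>\<rightarrow> c))" by (simp add: funpow_swap1)
  then have "\<Gamma> \<turnstile>\<^sub>L imp_pow n a (b \<^bold>\<rightarrow> (a \<^bold>\<rightarrow> c))"
    by (rule luk_deriv.mp[OF _ imp_pow_mono[OF luk_exchange]])
  then show ?case using Suc.IH[of "a \<^bold>\<rightarrow> c"] by (simp add: funpow_swap1)
qed simp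

text \<open>Without contraction a premise may be needed several times, hence an unspecified number
  of copies; modus ponens adds these numbers.\<close>

lemma luk_deduction:
  assumes "insert a \<Gamma> \<turnstile>\<^sub>L b"
  shows "\<exists>n. \<Gamma> \<turnstile>\<^sub>L imp_pow n a b"
  using assms
proof (induction rule: luk_deriv.induct)
  case (prem b)
  then consider "b = a" | "b \<in> \<Gamma>" by blast
  then show ?case
  proof cases
    case 1
    then show ?thesis using luk_self by (intro exI[of _ 1]) simp
  next
    case 2
    then show ?thesis using luk_deriv.prem by (intro exI[of _ 0]) simp
  qed
next
  case (mp b c)
  then obtain n m where n: "\<Gamma> \<turnstile>\<^sub>L imp_pow n a b" and m: "\<Gamma> \<turnstile>\<^sub>L imp_pow m a (b \<^bold>\<rightarrow> c)" by blast
  have "\<Gamma> \<turnstile>\<^sub>L imp_pow n a (imp_pow m a c)"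
    using luk_deriv.mp[OF n imp_pow_mono[OF imp_pow_exch[OF m]]] .
  then show ?case by (intro exI[of _ "n + m"]) (simp add: funpow_add)
qed (rule exI[of _ 0], simp add: luk_deriv.intros)+

text \<open>Two suffixings of p -> d turn the join of p and q into the join of d and q;
  \<open>L3\<close> rewrites the latter as (q -> d) -> d.\<close>

lemma luk_join:
  assumes "\<Gamma> \<turnstile>\<^sub>L (p \<^bold>\<rightarrow> q) \<^bold>\<rightarrow> q" "\<Gamma> \<turnstile>\<^sub>L p \<^bold>\<rightarrow> d" "\<Gamma> \<turnstile>\<^sub>L q \<^bold>\<rightarrow> d"
  shows "\<Gamma> \<turnstile>\<^sub>L d"
proof -
  have "\<Gamma> \<turnstile>\<^sub>L ((p \<^bold>\<rightarrow> q) \<^bold>\<rightarrow> q) \<^bold>\<rightarrow> ((d \<^bold>\<rightarrow> q) \<^bold>\<rightarrow> q)"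
    by (intro luk_suffix assms)
  then have "\<Gamma> \<turnstile>\<^sub>L (q \<^bold>\<rightarrow> d) \<^bold>\<rightarrow> d"
    using assms(1) luk_deriv.mp luk_deriv.L3 by blast
  then show ?thesis using assms(3) luk_deriv.mp by blast
qed

text \<open>The copies are peeled off one at a time, those of p before those of q: a formula with
  one copy fewer follows from one disjunct by assumption and from the other by weakening.\<close>

lemma luk_join_pow:
  assumes pq: "\<Gamma> \<turnstile>\<^sub>L (p \<^bold>\<rightarrow> q) \<^bold>\<rightarrow> q" and "\<Gamma> \<turnstile>\<^sub>L imp_pow n p d" "\<Gamma> \<turnstile>\<^sub>L imp_pow m q d"
  shows "\<Gamma> \<turnstile>\<^sub>L d"
proof -
  have 1: "\<Gamma> \<turnstile>\<^sub>L d" if "\<Gamma> \<turnstile>\<^sub>L imp_pow n p d" "\<Gamma> \<turnstile>\<^sub>L q \<^bold>\<rightarrow> d" for n d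
    using that
  proof (induction n)
    case (Suc n)
    then have "\<Gamma> \<turnstile>\<^sub>L imp_pow n p d"
      using luk_join[OF pq] luk_syll[OF _ imp_pow_weaken] by fastforce
    then show ?case using Suc by blast
  qed simp
  show ?thesis
    using assms(3)
  proof (induction m)
    case (Suc m)
    then have "\<Gamma> \<turnstile>\<^sub>L imp_pow n p (imp_pow m q d)"
      using luk_deriv.mp[OF assms(2) imp_pow_mono[OF imp_pow_weaken]] by blast
    then show ?case using 1 Suc by simp
  qed simp
qed

text \<open>The algebraic identity, read in the Lindenbaum algebra, replaces a derivation in the
  calculus.\<close>

lemma luk_prelinear: "\<Gamma> \<turnstile>\<^sub>L ((a \<^bold>\<rightarrow> b) \<^bold>\<rightarrow> (b \<^bold>\<rightarrow> a)) \<^bold>\<rightarrow> (b \<^bold>\<rightarrow> a)"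
proof -
  interpret mv_algebra "range (nf \<Gamma>)" "nf_add \<Gamma>" "nf_neg \<Gamma>" "nf \<Gamma> \<^bold>\<bottom>"
    by (rule mv_algebra_lindenbaum)
  show ?thesis
    using prelinear[of "nf \<Gamma> a" "nf \<Gamma> b"] by (simp add: nf_oplus nf_neg nf_top_iff)
qed

text \<open>A theory maximal among those not proving d is prime: if neither p nor q were provable,
  adding either one would yield d, and a provable join would then yield d outright. Prelinearity
  supplies the joins of a -> b and b -> a.\<close>

lemma prime_extension:
  assumes "\<not> \<Gamma> \<turnstile>\<^sub>L d"
  shows "\<exists>T. \<Gamma> \<subseteq> T \<and> \<not> T \<turnstile>\<^sub>L d \<and> (\<forall>a b. T \<turnstile>\<^sub>L a \<^bold>\<rightarrow> b \<or> T \<turnstile>\<^sub>L b \<^bold>\<rightarrow> a)"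
proof -
  define \<A> where "\<A> = {T. \<Gamma> \<subseteq> T \<and> \<not> T \<turnstile>\<^sub>L d}"
  have "\<exists>T \<in> \<A>. \<forall>T' \<in> \<A>. T \<subseteq> T' \<longrightarrow> T' = T"
  proof (rule subset_Zorn_nonempty)
    show "\<A> \<noteq> {}" using assms by (auto simp: \<A>_def)
    fix C assume C: "C \<noteq> {}" "subset.chain \<A> C"
    have "\<not> \<Union> C \<turnstile>\<^sub>L d"
    proof
      assume "\<Union> C \<turnstile>\<^sub>L d"
      then obtain \<Delta> where "finite \<Delta>" "\<Delta> \<subseteq> \<Union> C" "\<Delta> \<turnstile>\<^sub>L d" using luk_finite by blast
      moreover obtain T where "T \<in> C" "\<Delta> \<subseteq> T"
        using finite_subset_Union_chain[OF calculation(1,2) C] by blast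
      ultimately show False
        using C(2) luk_mono by (force simp: subset.chain_def \<A>_def)
    qed
    moreover have "\<Gamma> \<subseteq> \<Union> C"
      using C unfolding subset.chain_def \<A>_def by blast
    ultimately show "\<Union> C \<in> \<A>"
      by (simp add: \<A>_def)
  qed
  then obtain T where TA: "T \<in> \<A>" and Tmax: "\<forall>T' \<in> \<A>. T \<subseteq> T' \<longrightarrow> T' = T" ..
  then have T: "\<Gamma> \<subseteq> T" "\<not> T \<turnstile>\<^sub>L d" by (auto simp: \<A>_def)
  have max: "T' = T" if "T \<subseteq> T'" "\<not> T' \<turnstile>\<^sub>L d" for T'
    using Tmax that T by (auto simp: \<A>_def)
  have "T \<turnstile>\<^sub>L p \<or> T \<turnstile>\<^sub>L q" if "T \<turnstile>\<^sub>L (p \<^bold>\<rightarrow> q) \<^bold>\<rightarrow> q" for p q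
  proof (rule ccontr)
    assume "\<not> (T \<turnstile>\<^sub>L p \<or> T \<turnstile>\<^sub>L q)"
    then have "p \<notin> T" "q \<notin> T" by (auto intro: luk_deriv.prem)
    then have "insert p T \<turnstile>\<^sub>L d" "insert q T \<turnstile>\<^sub>L d" using max by blast+
    then show False using luk_deduction luk_join_pow[OF that] T(2) by blast
  qed
  then show ?thesis using T luk_prelinear by blast
qed

lemma mv_chain_lindenbaum:
  assumes "\<And>a b. T \<turnstile>\<^sub>L a \<^bold>\<rightarrow> b \<or> T \<turnstile>\<^sub>L b \<^bold>\<rightarrow> a" "\<not> T \<turnstile>\<^sub>L d"
  shows "mv_chain (range (nf T)) (nf_add T) (nf_neg T) (nf T \<^bold>\<bottom>)"
proof -
  interpret mv_algebra "range (nf T)" "nf_add T" "nf_neg T" "nf T \<^bold>\<bottom>"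
    by (rule mv_algebra_lindenbaum)
  have "\<not> T \<turnstile>\<^sub>L \<^bold>\<bottom>"
  proof
    assume "T \<turnstile>\<^sub>L \<^bold>\<bottom>"
    then have "T \<turnstile>\<^sub>L d \<^bold>\<oplus> \<^bold>\<bottom>"
      by (rule luk_deriv.mp[OF luk_weaken luk_deriv.imp_oplus])
    then show False using assms(2) luk_deriv.mp luk_oplus_bot(1) by blast
  qed
  then have "nf T \<^bold>\<bottom> \<noteq> nf T (\<^bold>\<not> nf T \<^bold>\<bottom>)"
    by (simp add: nf_neg nf_top_iff)
  then show ?thesis
    using assms(1) by unfold_locales (auto simp: nf_oplus nf_neg nf_top_iff)
qed

section \<open>Fourier-Motzkin elimination over the integers\<close>

text \<open>Coefficient vectors are kept apart from their evaluation, since the same vectors are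
  evaluated in the reals here and in Chang's group by \<open>gval\<close>.\<close>

definition lin :: "'i set \<Rightarrow> ('i \<Rightarrow> int) \<Rightarrow> ('i \<Rightarrow> real) \<Rightarrow> real" where
  "lin I c y = (\<Sum>i\<in>I. of_int (c i) * y i)"

lemma lin_plus: "lin I (c + d) y = lin I c y + lin I d y"
  by (simp add: lin_def sum.distrib algebra_simps)

lemma lin_minus: "lin I (c - d) y = lin I c y - lin I d y"
  by (simp add: lin_def sum_subtractf algebra_simps)

lemma lin_uminus: "lin I (- c) y = - lin I c y"
  by (simp add: lin_def sum_negf)

lemma lin_cmult: "lin I (\<lambda>i. n * c i) y = of_int n * lin I c y"
  by (simp add: lin_def sum_distrib_left algebra_simps)

lemma lin_upd:
  assumes "finite I" "x \<in> I"
  shows "lin I c (y(x := t)) = lin I c y + of_int (c x) * (t - y x)"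
proof -
  have "(\<Sum>i\<in>I. of_int (c i) * ((y(x := t)) i - y i)) = (\<Sum>i\<in>I. if i = x then of_int (c x) * (t - y x) else 0)"
    by (rule sum.cong) auto
  also have "\<dots> = of_int (c x) * (t - y x)"
    using assms by simp
  finally show ?thesis
    by (simp add: lin_def right_diff_distrib sum_subtractf)
qed

text \<open>A positive multiple is a repeated sum; the multiple 0 is left out because closure under
  addition does not put 0 into V.\<close>

lemma cone_cmult:
  fixes V :: "('i \<Rightarrow> int) set"
  assumes "\<And>a b. a \<in> V \<Longrightarrow> b \<in> V \<Longrightarrow> a + b \<in> V" "c \<in> V" "n > 0"
  shows "(\<lambda>i. n * c i) \<in> V"
proof -
  have "(\<lambda>i. int (Suc k) * c i) \<in> V" for k
  proof (induction k)
    case (Suc k)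
    have "(\<lambda>i. int (Suc (Suc k)) * c i) = (\<lambda>i. int (Suc k) * c i) + c"
      by (auto simp: algebra_simps)
    then show ?case using Suc assms by metis
  qed (use assms in simp)
  from this[of "nat n - 1"] show ?thesis using assms(3) by simp
qed

lemma real_between:
  fixes L U :: "real set"
  assumes "finite L" "finite U" "\<And>l u. l \<in> L \<Longrightarrow> u \<in> U \<Longrightarrow> l \<le> u"
  obtains t where "\<And>l. l \<in> L \<Longrightarrow> l \<le> t" "\<And>u. u \<in> U \<Longrightarrow> t \<le> u"
proof (cases "L = {}")
  case True
  show ?thesis
  proof (cases "U = {}")
    case False
    then show ?thesis using that[of "Min U"] True assms by auto
  qed (use True that in auto)
next
  case False
  show ?thesis
    by (rule that[of "Max L"]) (use False assms in auto)
qed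

text \<open>The quantification over \<open>V\<close> says that \<open>K'\<close> lies in the additive semigroup
  generated by \<open>K\<close>: so elimination is sound in every ordered abelian group, while solvability
  is only reflected back to the reals.\<close>

lemma fm_step:
  fixes K :: "('i \<Rightarrow> int) set"
  assumes I: "finite I" "x \<in> I" and K: "finite K"
  shows "\<exists>K'. finite K' \<and> (\<forall>c\<in>K'. c x = 0) \<and>
    (\<forall>V. K \<subseteq> V \<longrightarrow> (\<forall>a\<in>V. \<forall>b\<in>V. a + b \<in> V) \<longrightarrow> K' \<subseteq> V) \<and>
    (\<forall>y. (\<forall>c\<in>K'. lin I c y \<ge> 0) \<longrightarrow> (\<exists>t. \<forall>c\<in>K. lin I c (y(x := t)) \<ge> 0))"
proof -
  \<comment> \<open>For c x > 0 > d x both weights are positive integers, and they cancel the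
    coefficient of x.\<close>
  define comb where "comb c d = (\<lambda>i. - d x * c i) + (\<lambda>i. c x * d i)" for c d :: "'i \<Rightarrow> int"
  define P N Z where "P = {c \<in> K. c x > 0}" and "N = {c \<in> K. c x < 0}" and "Z = {c \<in> K. c x = 0}"
  define K' where "K' = Z \<union> (\<lambda>(c, d). comb c d) ` (P \<times> N)"
  show ?thesis
  proof (intro exI[of _ K'] conjI allI impI ballI)
    show "finite K'" using K by (simp add: K'_def Z_def P_def N_def)
    show "c x = 0" if "c \<in> K'" for c using that by (auto simp: K'_def Z_def comb_def)
    show "K' \<subseteq> V" if "K \<subseteq> V" and V: "\<forall>a\<in>V. \<forall>b\<in>V. a + b \<in> V" for V
    proof -
      have "comb c d \<in> V" if "c \<in> P" "d \<in> N" for c d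
      proof -
        have "(\<lambda>i. - d x * c i) \<in> V" "(\<lambda>i. c x * d i) \<in> V"
          using that V \<open>K \<subseteq> V\<close> by (auto simp: P_def N_def simp del: mult_minus_left intro!: cone_cmult)
        then show ?thesis using V by (simp add: comb_def)
      qed
      then show ?thesis using \<open>K \<subseteq> V\<close> by (auto simp: K'_def Z_def)
    qed
    fix y assume y: "\<forall>c\<in>K'. lin I c y \<ge> 0"
    \<comment> \<open>The value of coordinate x at which c vanishes, all others kept: a lower bound
      for t if c x > 0, an upper bound if c x < 0.\<close>
    define r where "r c = y x - lin I c y / of_int (c x)" for c
    have "r c \<le> r d" if "c \<in> P" "d \<in> N" for c d
    proof -
      have "lin I (comb c d) y \<ge> 0" using that y by (auto simp: K'_def)
      then have "of_int (- d x) * lin I c y + of_int (c x) * lin I d y \<ge> 0"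
        by (simp only: comb_def lin_plus lin_cmult)
      moreover have "of_int (c x) > (0::real)" "of_int (d x) < (0::real)"
        using that by (auto simp: P_def N_def)
      ultimately show ?thesis by (simp add: r_def field_simps)
    qed
    then obtain t where t: "\<And>l. l \<in> r ` P \<Longrightarrow> l \<le> t" "\<And>u. u \<in> r ` N \<Longrightarrow> t \<le> u"
      using K by (rule_tac real_between[of "r ` P" "r ` N"]) (auto simp: P_def N_def)
    show "\<exists>t. \<forall>c\<in>K. lin I c (y(x := t)) \<ge> 0"
    proof (intro exI ballI)
      fix c assume c: "c \<in> K"
      consider "c \<in> P" | "c \<in> N" | "c \<in> Z" using c by (force simp: P_def N_def Z_def)
      then show "lin I c (y(x := t)) \<ge> 0"
      proof cases
        case 1
        then have "of_int (c x) > (0::real)" "r c \<le> t" using t by (auto simp: P_def)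
        then show ?thesis by (simp add: lin_upd I r_def field_simps)
      next
        case 2
        then have "of_int (c x) < (0::real)" "t \<le> r c" using t by (auto simp: N_def)
        then show ?thesis by (simp add: lin_upd I r_def field_simps)
      next
        case 3
        then have "lin I c y \<ge> 0" using y by (auto simp: K'_def)
        then show ?thesis using 3 by (simp add: lin_upd I Z_def)
      qed
    qed
  qed
qed

lemma fourier_motzkin:
  fixes K :: "('i \<Rightarrow> int) set"
  assumes "finite I" "X \<subseteq> I" "finite K"
  shows "\<exists>K'. finite K' \<and> (\<forall>c\<in>K'. \<forall>x\<in>X. c x = 0) \<and>
    (\<forall>V. K \<subseteq> V \<longrightarrow> (\<forall>a\<in>V. \<forall>b\<in>V. a + b \<in> V) \<longrightarrow> K' \<subseteq> V) \<and>
    (\<forall>y. (\<forall>c\<in>K'. lin I c y \<ge> 0) \<longrightarrow> (\<exists>z. (\<forall>i. i \<notin> X \<longrightarrow> z i = y i) \<and> (\<forall>c\<in>K. lin I c z \<ge> 0)))"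
proof -
  have "finite X" using assms finite_subset by blast
  then show ?thesis using assms(2)
  proof (induction X)
    case empty
    then show ?case using assms(3) by (intro exI[of _ K]) auto
  next
    case (insert x X)
    then have "X \<subseteq> I" "x \<in> I" by auto
    from insert.IH[OF \<open>X \<subseteq> I\<close>] obtain K1 where K1: "finite K1" "\<forall>c\<in>K1. \<forall>x\<in>X. c x = 0"
      "\<forall>V. K \<subseteq> V \<longrightarrow> (\<forall>a\<in>V. \<forall>b\<in>V. a + b \<in> V) \<longrightarrow> K1 \<subseteq> V"
      "\<forall>y. (\<forall>c\<in>K1. lin I c y \<ge> 0) \<longrightarrow> (\<exists>z. (\<forall>i. i \<notin> X \<longrightarrow> z i = y i) \<and> (\<forall>c\<in>K. lin I c z \<ge> 0))"
      by (elim exE conjE) (rule that)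
    from fm_step[OF assms(1) \<open>x \<in> I\<close> K1(1)] obtain K2 where K2: "finite K2" "\<forall>c\<in>K2. c x = 0"
      "\<forall>V. K1 \<subseteq> V \<longrightarrow> (\<forall>a\<in>V. \<forall>b\<in>V. a + b \<in> V) \<longrightarrow> K2 \<subseteq> V"
      "\<forall>y. (\<forall>c\<in>K2. lin I c y \<ge> 0) \<longrightarrow> (\<exists>t. \<forall>c\<in>K1. lin I c (y(x := t)) \<ge> 0)"
      by (elim exE conjE) (rule that)
    show ?case
    proof (intro exI[of _ K2] conjI ballI allI impI)
      fix c i assume "c \<in> K2" "i \<in> insert x X"
      then show "c i = 0"
        using K2(2) K2(3)[rule_format, of "{c. c i = 0}"] K1(2) by auto
    next
      fix y assume "\<forall>c\<in>K2. lin I c y \<ge> 0"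
      then obtain t where "\<forall>c\<in>K1. lin I c (y(x := t)) \<ge> 0" using K2(4) by blast
      then obtain z where "\<forall>i. i \<notin> X \<longrightarrow> z i = (y(x := t)) i" "\<forall>c\<in>K. lin I c z \<ge> 0"
        using K1(4) by blast
      then show "\<exists>z. (\<forall>i. i \<notin> insert x X \<longrightarrow> z i = y i) \<and> (\<forall>c\<in>K. lin I c z \<ge> 0)"
        by (intro exI[of _ z]) auto
    next
      fix V assume "K \<subseteq> V" "\<forall>a\<in>V. \<forall>b\<in>V. a + b \<in> V"
      then show "K2 \<subseteq> V" using K1(3) K2(3) by simp
    qed (rule K2(1))
  qed
qed

definition delta :: "'i \<Rightarrow> 'i \<Rightarrow> int" where
  "delta a = (\<lambda>i. if i = a then 1 else 0)"

lemma lin_delta: "finite I \<Longrightarrow> a \<in> I \<Longrightarrow> lin I (delta a) y = y a"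
proof -
  assume "finite I" "a \<in> I"
  moreover have "lin I (delta a) y = (\<Sum>i\<in>I. if i = a then y i else 0)"
    unfolding lin_def delta_def by (rule sum.cong) auto
  ultimately show ?thesis by simp
qed

section \<open>Linear systems of formulas\<close>

lemma truth_simps [simp]:
  "truth v (Var p) = v p" "truth v \<^bold>\<bottom> = 0" "truth v (\<^bold>\<not> a) = 1 - truth v a"
  "truth v (a \<^bold>\<oplus> b) = min 1 (truth v a + truth v b)"
  by (simp_all add: truth_def std_add_def std_neg_def)

lemma truth_range:
  assumes "range v \<subseteq> {0..1}"
  shows "truth v a \<ge> 0" "truth v a \<le> 1"
  using mv_algebra.mv_eval_closed[OF mv_algebra_std assms, of a] by (auto simp: truth_def)

lemma truth_cong: "(\<And>p. p \<in> vars a \<Longrightarrow> v p = w p) \<Longrightarrow> truth v a = truth w a"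
  by (induction a) auto

lemma truth_sound:
  assumes "\<Gamma> \<turnstile>\<^sub>L a" "range v \<subseteq> {0..1}" "\<And>c. c \<in> \<Gamma> \<Longrightarrow> truth v c = 1"
  shows "truth v a = 1"
  using mv_algebra.luk_sound[OF mv_algebra_std assms(1,2)] assms(3) by (simp add: truth_def std_neg_def)

primrec subf :: "'v luk \<Rightarrow> 'v luk set" where
  "subf (Var p) = {Var p}"
| "subf \<^bold>\<bottom> = {\<^bold>\<bottom>}"
| "subf (\<^bold>\<not> a) = insert (\<^bold>\<not> a) (subf a)"
| "subf (a \<^bold>\<oplus> b) = insert (a \<^bold>\<oplus> b) (subf a \<union> subf b)"

lemma finite_subf: "finite (subf a)"
  by (induction a) auto

lemma subf_self: "a \<in> subf a"
  by (cases a) auto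

text \<open>\<top> has to belong to the set because the systems built over it are homogeneous, and
  its unknown stands for the constant 1.\<close>

definition closed_set :: "'v luk set \<Rightarrow> bool" where
  "closed_set S \<longleftrightarrow> \<^bold>\<top> \<in> S \<and> (\<forall>a. \<^bold>\<not> a \<in> S \<longrightarrow> a \<in> S) \<and> (\<forall>a b. a \<^bold>\<oplus> b \<in> S \<longrightarrow> a \<in> S \<and> b \<in> S)"

lemma subf_closed: "\<^bold>\<not> b \<in> subf a \<Longrightarrow> b \<in> subf a" "b \<^bold>\<oplus> c \<in> subf a \<Longrightarrow> b \<in> subf a \<and> c \<in> subf a"
  by (induction a) (auto simp: subf_self)

lemma closed_set_subf: "closed_set (subf \<^bold>\<top> \<union> (\<Union>a\<in>A. subf a))"
  by (auto simp: closed_set_def dest: subf_closed)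

text \<open>The unknown indexed by a formula is its truth value, scaled by the value of \<open>\<^bold>\<top>\<close>;
  \<open>\<sigma>\<close> contains the disjunctions whose truncated sum is cut off at \<open>1\<close>.\<close>

fun local_constraints :: "'v luk set \<Rightarrow> 'v luk \<Rightarrow> ('v luk \<Rightarrow> int) set" where
  "local_constraints \<sigma> (Var p) = {}"
| "local_constraints \<sigma> \<^bold>\<bottom> = {- delta \<^bold>\<bottom>}"
| "local_constraints \<sigma> (\<^bold>\<not> a) =
    {delta a + delta (\<^bold>\<not> a) - delta \<^bold>\<top>, delta \<^bold>\<top> - (delta a + delta (\<^bold>\<not> a))}"
| "local_constraints \<sigma> (a \<^bold>\<oplus> b) =
    (if a \<^bold>\<oplus> b \<in> \<sigma> then {delta (a \<^bold>\<oplus> b) - delta \<^bold>\<top>, delta a + delta b - delta \<^bold>\<top>}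
     else {delta (a \<^bold>\<oplus> b) - (delta a + delta b), delta a + delta b - delta (a \<^bold>\<oplus> b)})"

definition constraints :: "'v luk set \<Rightarrow> 'v luk set \<Rightarrow> ('v luk \<Rightarrow> int) set" where
  "constraints S \<sigma> = (\<Union>a\<in>S. {delta a, delta \<^bold>\<top> - delta a} \<union> local_constraints \<sigma> a)"

lemma finite_constraints: "finite S \<Longrightarrow> finite (constraints S \<sigma>)"
proof -
  have "finite (local_constraints \<sigma> a)" for a
    by (cases a) auto
  then show "finite S \<Longrightarrow> finite (constraints S \<sigma>)"
    by (simp add: constraints_def)
qed

lemma constraints_truth:
  assumes "range v \<subseteq> {0..1}" "finite S" "closed_set S"
  shows "\<exists>\<sigma>\<subseteq>S. \<forall>c\<in>constraints S \<sigma>. lin S c (truth v) \<ge> 0"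
proof (intro exI conjI ballI)
  \<comment> \<open>A sum equal to 1 satisfies both kinds of constraints; here it is counted as cut
    off.\<close>
  define \<sigma> where "\<sigma> = {c \<in> S. \<exists>a b. c = a \<^bold>\<oplus> b \<and> truth v a + truth v b \<ge> 1}"
  show "\<sigma> \<subseteq> S" by (auto simp: \<sigma>_def)
  fix c assume "c \<in> constraints S \<sigma>"
  then obtain a where a: "a \<in> S" and c: "c \<in> {delta a, delta \<^bold>\<top> - delta a} \<union> local_constraints \<sigma> a"
    unfolding constraints_def by (rule UN_E)
  have S: "\<^bold>\<top> \<in> S" using assms(3) by (simp add: closed_set_def)
  note s = lin_plus lin_minus lin_uminus lin_delta assms(2) truth_range[OF assms(1)]
  show "lin S c (truth v) \<ge> 0"
  proof (cases "c \<in> local_constraints \<sigma> a")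
    case False
    then show ?thesis using c a S by (auto simp: s)
  next
    case True
    then show ?thesis
    proof (cases a)
      case (Oplus d e)
      then have "d \<in> S" "e \<in> S" using a assms(3) unfolding closed_set_def by blast+
      then show ?thesis using True Oplus a S by (auto simp: s \<sigma>_def split: if_splits)
    next
      case (Neg d)
      then have "d \<in> S" using a assms(3) unfolding closed_set_def by blast
      then show ?thesis using True Neg a S by (auto simp: s)
    qed (use a S in \<open>auto simp: s\<close>)
  qed
qed

text \<open>By homogeneity a solution is a truth function multiplied by y \<top>. If y \<top> = 0
  then all unknowns are 0; this degenerate case occurs later, for regions of weight 0 in a convex
  combination.\<close>

lemma constraints_solution:
  assumes "finite S" "closed_set S" and y: "\<forall>c\<in>constraints S \<sigma>. lin S c y \<ge> 0"
  shows "\<And>a. a \<in> S \<Longrightarrow> 0 \<le> y a" "\<And>a. a \<in> S \<Longrightarrow> y a \<le> y \<^bold>\<top>"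
    and "\<And>a v. a \<in> S \<Longrightarrow> (\<And>p. Var p \<in> S \<Longrightarrow> y (Var p) = y \<^bold>\<top> * v p) \<Longrightarrow> y a = y \<^bold>\<top> * truth v a"
proof -
  have cl: "\<^bold>\<top> \<in> S" using assms(2) by (simp add: closed_set_def)
  have nn: "0 \<le> y a \<and> y a \<le> y \<^bold>\<top>" if "a \<in> S" for a
    using bspec[OF y, of "delta a"] bspec[OF y, of "delta \<^bold>\<top> - delta a"] that cl assms(1)
    by (force simp: constraints_def lin_minus lin_delta)
  show "\<And>a. a \<in> S \<Longrightarrow> 0 \<le> y a" "\<And>a. a \<in> S \<Longrightarrow> y a \<le> y \<^bold>\<top>"
    using nn by auto
  have loc: "lin S c y \<ge> 0" if "a \<in> S" "c \<in> local_constraints \<sigma> a" for a c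
    using that y by (auto simp: constraints_def)
  note s = lin_plus lin_minus lin_uminus lin_delta assms(1)
  show "y a = y \<^bold>\<top> * truth v a" if "a \<in> S" "\<And>p. Var p \<in> S \<Longrightarrow> y (Var p) = y \<^bold>\<top> * v p" for a v
    using that(1)
  proof (induction a)
    case (Var p)
    then show ?case using that(2) by simp
  next
    case Bot
    then show ?case using loc[OF Bot, of "- delta \<^bold>\<bottom>"] nn by (simp add: s) (meson antisym)
  next
    case (Neg a)
    then have "a \<in> S" using assms(2) unfolding closed_set_def by blast
    moreover from this have "y a + y (\<^bold>\<not> a) = y \<^bold>\<top>"
      using loc[OF Neg.prems, of "delta a + delta (\<^bold>\<not> a) - delta \<^bold>\<top>"]
        loc[OF Neg.prems, of "delta \<^bold>\<top> - (delta a + delta (\<^bold>\<not> a))"] Neg.prems cl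
      by (simp add: s)
    ultimately show ?case using Neg.IH by (simp add: algebra_simps)
  next
    case (Oplus a b)
    then have ab: "a \<in> S" "b \<in> S" using assms(2) unfolding closed_set_def by blast+
    then have IH: "y a = y \<^bold>\<top> * truth v a" "y b = y \<^bold>\<top> * truth v b" using Oplus.IH by auto
    have T: "y \<^bold>\<top> \<ge> 0" "y (a \<^bold>\<oplus> b) \<le> y \<^bold>\<top>" using nn cl Oplus.prems by auto
    have eq: "y \<^bold>\<top> * truth v (a \<^bold>\<oplus> b) = min (y \<^bold>\<top>) (y a + y b)"
      using T by (simp add: IH min_mult_distrib_left distrib_left)
    show ?case
    proof (cases "a \<^bold>\<oplus> b \<in> \<sigma>")
      case True
      then have "y (a \<^bold>\<oplus> b) \<ge> y \<^bold>\<top>" "y a + y b \<ge> y \<^bold>\<top>"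
        using loc[OF Oplus.prems, of "delta (a \<^bold>\<oplus> b) - delta \<^bold>\<top>"]
          loc[OF Oplus.prems, of "delta a + delta b - delta \<^bold>\<top>"] Oplus.prems ab cl
        by (simp_all add: s)
      then show ?thesis using T eq by linarith
    next
      case False
      then have "y (a \<^bold>\<oplus> b) = y a + y b"
        using loc[OF Oplus.prems, of "delta (a \<^bold>\<oplus> b) - (delta a + delta b)"]
          loc[OF Oplus.prems, of "delta a + delta b - delta (a \<^bold>\<oplus> b)"] Oplus.prems ab
        by (simp add: s)
      then show ?thesis using T eq by linarith
    qed
  qed
qed

section \<open>Completeness of Lukasiewicz logic\<close>

context mv_chain
begin

definition gval :: "'i set \<Rightarrow> ('i \<Rightarrow> int \<times> 'a) \<Rightarrow> ('i \<Rightarrow> int) \<Rightarrow> int \<times> 'a" where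
  "gval I x c = finprod chang_group (\<lambda>i. x i [^]\<^bsub>chang_group\<^esub> c i) I"

lemma nonneg_carrier: "e \<in> nonneg \<Longrightarrow> e \<in> carrier chang_group"
  by (auto simp: nonneg_def chang_group_def)

lemma emb_carrier: "a \<in> M \<Longrightarrow> emb a \<in> carrier chang_group"
  by (intro nonneg_carrier emb_nonneg)

lemma zero_nonneg: "(0, zero) \<in> nonneg"
  using nontrivial zero_closed by (simp add: nonneg_def)

lemma chang_simps: "x \<otimes>\<^bsub>chang_group\<^esub> y = gadd x y" "\<one>\<^bsub>chang_group\<^esub> = (0, zero)"
  by (simp_all add: chang_group_def)

context
  fixes I :: "'i set" and x :: "'i \<Rightarrow> int \<times> 'a"
  assumes I: "finite I" and x: "x \<in> I \<rightarrow> carrier chang_group"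
begin

interpretation G: comm_group chang_group
  by (rule comm_group_chang)

lemma gval_closed: "gval I x c \<in> carrier chang_group"
  unfolding gval_def using x by (intro G.finprod_closed) auto

lemma gval_plus: "gval I x (c + d) = gadd (gval I x c) (gval I x d)"
proof -
  have "gval I x (c + d) = finprod chang_group
      (\<lambda>i. x i [^]\<^bsub>chang_group\<^esub> c i \<otimes>\<^bsub>chang_group\<^esub> x i [^]\<^bsub>chang_group\<^esub> d i) I"
    unfolding gval_def using x by (intro G.finprod_cong) (auto simp: G.int_pow_mult Pi_iff simp_implies_def)
  also have "\<dots> = gval I x c \<otimes>\<^bsub>chang_group\<^esub> gval I x d"
    unfolding gval_def using x by (intro G.finprod_multf) auto
  finally show ?thesis by (simp add: chang_simps)
qed

lemma gval_zero: "gval I x 0 = (0, zero)"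
  unfolding gval_def by (simp add: G.finprod_one_eqI chang_simps)

lemma gval_delta: "a \<in> I \<Longrightarrow> gval I x (delta a) = x a"
proof -
  assume a: "a \<in> I"
  have "gval I x (delta a) = finprod chang_group (\<lambda>i. if a = i then x i else \<one>\<^bsub>chang_group\<^esub>) I"
    unfolding gval_def delta_def using x by (intro G.finprod_cong) (auto simp: G.int_pow_1 Pi_iff simp_implies_def)
  also have "\<dots> = x a"
    using a I x by (intro G.finprod_singleton) auto
  finally show ?thesis .
qed

lemma gval_minus:
  assumes "gval I x c = gadd (gval I x d) e" "e \<in> carrier chang_group"
  shows "gval I x (c - d) = e"
proof -
  have "gadd (gval I x d) (gval I x (c - d)) = gadd (gval I x d) e"
    using gval_plus[of d "c - d"] assms(1) by simp
  then show ?thesis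
    using gval_closed assms(2) by (simp add: G.group_l_invI chang_simps[symmetric])
qed

lemma gval_minus_eq: "gval I x c = gval I x d \<Longrightarrow> gval I x (c - d) = (0, zero)"
  using G.r_one[of "gval I x d"] gval_closed G.one_closed
  by (intro gval_minus) (auto simp: chang_simps)

text \<open>If c a = -(n + 1), then x a, n copies of x a and the value of c add up to 0. The last
  two together are non-negative, so antisymmetry would give x a = 0. The case n = 0 is separate
  because \<open>cone_cmult\<close> needs a positive factor.\<close>

lemma gval_neg_multiple:
  assumes "a \<in> I" "x a \<in> nonneg" "x a \<noteq> (0, zero)" "\<And>i. i \<in> I \<Longrightarrow> i \<noteq> a \<Longrightarrow> c i = 0"
    "gval I x c \<in> nonneg"
  shows "c a \<ge> 0"
proof (rule ccontr)
  assume neg: "\<not> c a \<ge> 0"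
  define V where "V = {c. gval I x c \<in> nonneg}"
  have V: "b + d \<in> V" if "b \<in> V" "d \<in> V" for b d
    using that by (simp add: V_def gval_plus nonneg_closed)
  define b where "b = (\<lambda>i. (- c a - 1) * delta a i)"
  have b: "b \<in> V"
  proof (cases "- c a - 1 = 0")
    case True
    then have "b = 0" by (auto simp: b_def)
    then show ?thesis by (simp add: V_def gval_zero zero_nonneg)
  next
    case False
    then show ?thesis
      unfolding b_def using neg assms by (intro cone_cmult V) (auto simp: V_def gval_delta)
  qed
  have "gval I x (delta a + (b + c)) = gval I x 0"
    unfolding gval_def using x assms(4)
    by (intro G.finprod_cong) (auto simp: simp_implies_def b_def delta_def)
  then have "gadd (x a) (gval I x (b + c)) = (0, zero)"
    using assms(1) by (simp add: gval_plus[of "delta a"] gval_delta gval_zero)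
  moreover have "gval I x (b + c) \<in> nonneg"
    using V[OF b, of c] assms(5) by (simp add: V_def)
  ultimately show False
    using nonneg_add_eq_zero assms by blast
qed

end

lemma emb_eq_zero: "a \<in> M \<Longrightarrow> emb a = (0, zero) \<Longrightarrow> a = zero"
  by (auto simp: emb_def split: if_splits)

text \<open>A valuation in a chain refuting a consequence is turned, by elimination, into one in the
  reals. The strict inequality is encoded by the extra unknown \<open>t\<close>.\<close>

lemma refute_in_reals:
  fixes v :: "'v \<Rightarrow> 'a" and \<Gamma> :: "'v luk set"
  defines "h \<equiv> mv_eval add neg zero v"
  assumes "finite \<Gamma>" and v: "range v \<subseteq> M"
    and \<Gamma>: "\<And>c. c \<in> \<Gamma> \<Longrightarrow> h c = mone" and d: "h d \<noteq> mone"
  shows "\<exists>w. range w \<subseteq> {0..1} \<and> (\<forall>c\<in>\<Gamma>. truth w c = 1) \<and> truth w d \<noteq> 1"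
proof -
  define S where "S = subf \<^bold>\<top> \<union> (\<Union>a\<in>insert d \<Gamma>. subf a)"
  have fin: "finite S" using assms(2) by (simp add: S_def finite_subf)
  have cl: "closed_set S" unfolding S_def by (rule closed_set_subf)
  then have T: "\<^bold>\<top> \<in> S" by (simp add: closed_set_def)
  have GS: "\<Gamma> \<subseteq> S" "d \<in> S" by (auto simp: S_def subf_self)
  have h: "h a \<in> M" for a using v unfolding h_def by (rule mv_eval_closed)
  have [simp]: "h \<^bold>\<bottom> = zero" "h (\<^bold>\<not> a) = neg (h a)" "h (a \<^bold>\<oplus> b) = add (h a) (h b)" for a b
    by (simp_all add: h_def)
  \<comment> \<open>The unknown t needs an index outside S of the same type, so there must be
    infinitely many formulas; \<open>Neg\<close> is injective but misses \<bottom>.\<close>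
  have "inj (Neg :: 'v luk \<Rightarrow> _)" "\<not> surj (Neg :: 'v luk \<Rightarrow> _)"
    by (auto simp: inj_def surj_def intro!: exI[of _ "\<^bold>\<bottom>"])
  then have "infinite (UNIV :: 'v luk set)" using finite_UNIV_inj_surj by blast
  then obtain t where t: "t \<notin> S" using fin ex_new_if_finite by blast
  define I where "I = insert t S"
  have I: "finite I" using fin by (simp add: I_def)
  define x where "x i = (if i = t then emb (neg (h d)) else emb (h i))" for i
  have x: "x \<in> I \<rightarrow> carrier chang_group"
    using h by (auto simp: x_def emb_carrier closed)
  have xS: "x a = emb (h a)" if "a \<in> S" for a using that t by (auto simp: x_def)
  have xt: "x t = emb (neg (h d))" by (simp add: x_def)
  define \<sigma> where "\<sigma> = {c. \<exists>a b. c = a \<^bold>\<oplus> b \<and> add (h a) (h b) = mone}"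
  \<comment> \<open>The last inequality keeps d below \<top> by at least t. In the group it is an
    equality, t being the negation of the value of d and hence positive. The gap is an unknown, not
    a fixed number, because that element may be infinitesimal.\<close>
  define K where "K = constraints S \<sigma> \<union> (\<lambda>c. delta c - delta \<^bold>\<top>) ` \<Gamma> \<union> {delta \<^bold>\<top> - delta d - delta t}"
  have K: "finite K" using fin assms(2) by (simp add: K_def finite_constraints)
  let ?g = "gval I x"
  note plus = gval_plus[OF I x] and minus = gval_minus[OF I x] and eq = gval_minus_eq[OF I x]
  have del: "?g (delta a) = emb (h a)" if "a \<in> S" for a
    using gval_delta[OF I x, of a] that by (simp add: xS I_def)
  have T1: "?g (delta \<^bold>\<top>) = (1, zero)" using del[OF T] by (simp add: emb_def)
  have le_top: "?g (delta \<^bold>\<top> - delta a) = emb (neg (h a))" if "a \<in> S" for a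
    by (rule minus) (use that h in \<open>auto simp: T1 del emb_neg emb_carrier closed\<close>)
  define V where "V = {c. ?g c \<in> nonneg}"
  have "K \<subseteq> V"
  proof -
    have local: "c \<in> V" if "a \<in> S" "c \<in> local_constraints \<sigma> a" for a c
    proof (cases a)
      case Bot
      then have "c = 0 - delta \<^bold>\<bottom>" using that by auto
      moreover have "?g (0 - delta \<^bold>\<bottom>) = (0, zero)"
        by (rule eq) (use that Bot nontrivial in \<open>simp add: gval_zero[OF I x] del emb_def\<close>)
      ultimately show ?thesis by (simp add: V_def zero_nonneg)
    next
      case (Neg b)
      then have "b \<in> S" using that cl unfolding closed_set_def by blast
      then have "?g (delta b + delta (\<^bold>\<not> b)) = ?g (delta \<^bold>\<top>)"
        using that Neg h by (simp add: plus del T1 emb_neg)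
      then have "?g c = (0, zero)"
        using that Neg eq eq[OF sym] by auto
      then show ?thesis by (simp add: V_def zero_nonneg)
    next
      case (Oplus b e)
      then have be: "b \<in> S" "e \<in> S" using that cl unfolding closed_set_def by blast+
      show ?thesis
      proof (cases "b \<^bold>\<oplus> e \<in> \<sigma>")
        case True
        then have o: "add (h b) (h e) = mone" by (auto simp: \<sigma>_def)
        have "?g (delta (b \<^bold>\<oplus> e)) = ?g (delta \<^bold>\<top>)"
          using that Oplus o by (simp add: del T1) (simp add: emb_def)
        moreover have "?g (delta b + delta e - delta \<^bold>\<top>) = emb (od (h b) (h e))"
          by (rule minus) (use be h o in \<open>auto simp: plus del T1 emb_add_overflow emb_carrier closed\<close>)
        ultimately show ?thesis
          using that Oplus True eq h by (auto simp: V_def zero_nonneg emb_nonneg closed)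
      next
        case False
        then have "add (h b) (h e) \<noteq> mone" by (auto simp: \<sigma>_def)
        then have "?g (delta (b \<^bold>\<oplus> e)) = ?g (delta b + delta e)"
          using that Oplus be h by (simp add: plus del emb_add add_neg_eq_one)
        then have "?g c = (0, zero)"
          using that Oplus False eq eq[OF sym] by auto
        then show ?thesis by (simp add: V_def zero_nonneg)
      qed
    qed (use that in simp)
    have "constraints S \<sigma> \<subseteq> V"
      unfolding constraints_def using local h
      by (auto simp: V_def del le_top emb_nonneg closed)
    moreover have "delta c - delta \<^bold>\<top> \<in> V" if "c \<in> \<Gamma>" for c
      using eq[of "delta c" "delta \<^bold>\<top>"] that GS del[of c] T1 \<Gamma>
      by (auto simp: V_def zero_nonneg emb_def)
    moreover have "delta \<^bold>\<top> - delta d - delta t \<in> V"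
      using eq[of "delta \<^bold>\<top> - delta d" "delta t"] le_top[OF GS(2)] gval_delta[OF I x, of t]
      by (simp add: V_def zero_nonneg xt I_def)
    ultimately show ?thesis by (auto simp: K_def)
  qed
  have "S \<subseteq> I" by (auto simp: I_def)
  from fourier_motzkin[OF I this K]
  obtain K' where K': "finite K'" "\<forall>c\<in>K'. \<forall>a\<in>S. c a = 0"
      "\<forall>V. K \<subseteq> V \<longrightarrow> (\<forall>a\<in>V. \<forall>b\<in>V. a + b \<in> V) \<longrightarrow> K' \<subseteq> V"
      "\<forall>y. (\<forall>c\<in>K'. lin I c y \<ge> 0) \<longrightarrow> (\<exists>z. (\<forall>i. i \<notin> S \<longrightarrow> z i = y i) \<and> (\<forall>c\<in>K. lin I c z \<ge> 0))"
    by (elim exE conjE) (rule that)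
  have "K' \<subseteq> V"
    using K'(3) \<open>K \<subseteq> V\<close> by (simp add: V_def plus nonneg_closed)
  \<comment> \<open>Only t survives the elimination, so a remaining inequality reads n t \<ge> 0 and
    is valid for a positive group element. This forces n \<ge> 0, and then t = 1 solves the system
    over the reals.\<close>
  have "c t \<ge> 0" if "c \<in> K'" for c
  proof (rule gval_neg_multiple[OF I x])
    show "x t \<noteq> (0, zero)"
      using emb_eq_zero[of "neg (h d)"] d h[of d] neg_neg[of "h d"] by (auto simp: xt closed)
    show "?g c \<in> nonneg" using that \<open>K' \<subseteq> V\<close> by (auto simp: V_def)
  qed (use that K'(2) h in \<open>auto simp: I_def xt emb_nonneg closed\<close>)
  moreover have "lin I c (\<lambda>_. 1) = c t" if "c \<in> K'" for c
  proof -
    have "(\<Sum>i\<in>S. real_of_int (c i)) = 0" using K'(2) that by (intro sum.neutral) auto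
    then show ?thesis using fin t by (simp add: lin_def I_def)
  qed
  ultimately have "lin I c (\<lambda>_. 1) \<ge> 0" if "c \<in> K'" for c
    using that by simp
  then obtain z where "\<forall>i. i \<notin> S \<longrightarrow> z i = (1 :: real)" and zK: "\<forall>c\<in>K. lin I c z \<ge> 0"
    using K'(4) by blast
  then have zt: "z t = 1" using t by blast
  have lin_S: "lin S c z = lin I c z" if "c t = 0" for c
    using that t fin by (simp add: lin_def I_def)
  have t0: "delta a t = 0" if "a \<in> S" for a using that t by (auto simp: delta_def)
  have ct: "c t = 0" if "c \<in> constraints S \<sigma>" for c
  proof -
    have "c t = 0" if "a \<in> S" "c \<in> local_constraints \<sigma> a" for a
    proof (cases a)
      case (Neg b)
      then have "b \<in> S" using that cl unfolding closed_set_def by blast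
      then show ?thesis using that Neg T by (auto simp: t0)
    next
      case (Oplus b e)
      then have "b \<in> S" "e \<in> S" using that cl unfolding closed_set_def by blast+
      then show ?thesis using that Oplus T by (auto simp: t0 split: if_splits)
    qed (use that in \<open>auto simp: t0\<close>)
    then show ?thesis using that T by (auto simp: constraints_def t0)
  qed
  have "\<forall>c\<in>constraints S \<sigma>. lin S c z \<ge> 0"
    using zK lin_S ct by (simp add: K_def)
  note sol = constraints_solution[OF fin cl this]
  note l = lin_minus lin_delta I
  \<comment> \<open>With t = 1 the scale z \<top> is at least 1 + z d; it is positive, and dividing
    by it produces truth values.\<close>
  have "z \<^bold>\<top> - z d \<ge> 1"
    using zK zt T GS by (simp add: K_def l I_def fin)
  then have pos: "z \<^bold>\<top> > 0" "z d \<noteq> z \<^bold>\<top>" using sol(1)[OF GS(2)] by auto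
  have z\<Gamma>: "z c = z \<^bold>\<top>" if "c \<in> \<Gamma>" for c
  proof -
    have "lin I (delta c - delta \<^bold>\<top>) z \<ge> 0" using zK that by (simp add: K_def)
    then have "z c \<ge> z \<^bold>\<top>" using that GS T by (simp add: l I_def fin subsetD)
    then show ?thesis using sol(2)[of c] that GS by force
  qed
  define w where "w p = (if Var p \<in> S then z (Var p) / z \<^bold>\<top> else 0)" for p
  have "range w \<subseteq> {0..1}"
    using sol(1,2) pos by (auto simp: w_def divide_le_eq)
  moreover have val: "z a = z \<^bold>\<top> * truth w a" if "a \<in> S" for a
    using that pos by (intro sol(3)) (auto simp: w_def)
  have "truth w c = 1" if "c \<in> \<Gamma>" for c
    using val[of c] z\<Gamma>[OF that] that GS pos by auto
  moreover have "truth w d \<noteq> 1"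
    using val[OF GS(2)] pos by auto
  ultimately show ?thesis by blast
qed

end

theorem luk_complete:
  assumes "finite \<Gamma>"
    and "\<And>v. range v \<subseteq> {0..1} \<Longrightarrow> (\<And>c. c \<in> \<Gamma> \<Longrightarrow> truth v c = 1) \<Longrightarrow> truth v d = 1"
  shows "\<Gamma> \<turnstile>\<^sub>L d"
proof (rule ccontr)
  assume "\<not> \<Gamma> \<turnstile>\<^sub>L d"
  then obtain T where T: "\<Gamma> \<subseteq> T" "\<not> T \<turnstile>\<^sub>L d" "\<And>a b. T \<turnstile>\<^sub>L a \<^bold>\<rightarrow> b \<or> T \<turnstile>\<^sub>L b \<^bold>\<rightarrow> a"
    using prime_extension by blast
  interpret mv_chain "range (nf T)" "nf_add T" "nf_neg T" "nf T \<^bold>\<bottom>"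
    by (rule mv_chain_lindenbaum[OF T(3,2)])
  \<comment> \<open>Under this valuation the value of a formula is its own class, so value 1 means
    provable from T.\<close>
  have eval: "mv_eval (nf_add T) (nf_neg T) (nf T \<^bold>\<bottom>) (\<lambda>p. nf T (Var p)) a = nf T a" for a
    by (induction a) (simp_all add: nf_neg nf_oplus)
  have "\<exists>w. range w \<subseteq> {0..1} \<and> (\<forall>c\<in>\<Gamma>. truth w c = 1) \<and> truth w d \<noteq> 1"
  proof (rule refute_in_reals[where v = "\<lambda>p. nf T (Var p)"])
    show "mv_eval (nf_add T) (nf_neg T) (nf T \<^bold>\<bottom>) (\<lambda>p. nf T (Var p)) c = nf_neg T (nf T \<^bold>\<bottom>)"
      if "c \<in> \<Gamma>" for c
      using that T(1) by (auto simp: eval nf_neg nf_top_iff intro: luk_deriv.prem)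
    show "mv_eval (nf_add T) (nf_neg T) (nf T \<^bold>\<bottom>) (\<lambda>p. nf T (Var p)) d \<noteq> nf_neg T (nf T \<^bold>\<bottom>)"
      using T(2) by (simp add: eval nf_neg nf_top_iff)
  qed (use assms(1) in auto)
  then show False using assms(2) by blast
qed

section \<open>Convex sets defined by formulas are rational polytopes\<close>

lemma sum_fun_apply: "(\<Sum>k\<in>A. f k) x = (\<Sum>k\<in>A. f k x)"
  by (induction A rule: infinite_finite_induct) auto

lemma lin_sum: "lin I (\<Sum>k\<in>A. f k) y = (\<Sum>k\<in>A. lin I (f k) y)"
  unfolding lin_def sum_fun_apply by (subst sum.swap) (simp add: sum_distrib_right)

lemma Var_subf: "Var p \<in> subf a \<Longrightarrow> p \<in> vars a"
  by (induction a) auto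

lemma lin_mono_neutral:
  assumes "finite J" "I \<subseteq> J" "\<And>i. i \<in> J \<Longrightarrow> i \<notin> I \<Longrightarrow> c i = 0"
  shows "lin J c y = lin I c y"
  unfolding lin_def using assms by (intro sum.mono_neutral_right) auto

lemma lin_Pair: "lin ({s} \<times> A) c y = lin A (\<lambda>a. c (s, a)) (\<lambda>a. y (s, a))"
proof -
  have "{s} \<times> A = Pair s ` A" by auto
  then show ?thesis by (simp add: lin_def sum.reindex inj_on_def)
qed

text \<open>The models of \<open>chi\<close> form a finite union of polytopes, one for each \<open>\<sigma>\<close>. When the union
  is convex it is the projection of a polyhedron with one scaled copy of the unknowns for each
  \<open>\<sigma>\<close>, whose vectors sum up to the given one.\<close>

lemma convex_models_hrep:
  fixes chi :: "'p luk"
  assumes E: "finite E" and vars: "vars chi \<subseteq> E" and conv: "convex (Models E chi)"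
  shows "\<exists>K :: (('p \<Rightarrow> int) \<times> int) set. finite K \<and> (\<forall>y\<in>cube E. y \<in> Models E chi \<longleftrightarrow>
    (\<forall>(c, k)\<in>K. (\<Sum>p\<in>E. of_int (c p) * y p) + of_int k \<ge> 0))"
proof -
  \<comment> \<open>The variables of E are added so that each coordinate has an unknown, also one
    not occurring in \<open>chi\<close>.\<close>
  define S where "S = subf \<^bold>\<top> \<union> (\<Union>a\<in>insert chi (Var ` E). subf a)"
  have fin: "finite S" using E by (simp add: S_def finite_subf)
  have cl: "closed_set S" unfolding S_def by (rule closed_set_subf)
  then have TS: "\<^bold>\<top> \<in> S" by (simp add: closed_set_def)
  have chiS: "chi \<in> S" by (auto simp: S_def subf_self)
  have VS: "Var p \<in> S \<longleftrightarrow> p \<in> E" for p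
    using vars by (auto simp: S_def dest: Var_subf)
  define B where "B = insert \<^bold>\<top> (Var ` E)"
  have B: "finite B" "B \<subseteq> S" using E TS VS by (auto simp: B_def)
  \<comment> \<open>Index (Some \<sigma>, a) is the unknown a in the copy for \<sigma>; index (None,
    a), for a in B, is the total over all copies. Eliminating X leaves conditions on the
    totals.\<close>
  define X where "X = Some ` Pow S \<times> S"
  define J where "J = X \<union> {None} \<times> B"
  have J: "finite J" using fin B by (simp add: J_def X_def)
  have XJ: "X \<subseteq> J" by (auto simp: J_def)
  define push where "push \<sigma> c = (\<lambda>(s, a). if s = Some \<sigma> \<and> a \<in> S then c a else (0 :: int))"
    for \<sigma> :: "'p luk set" and c :: "'p luk \<Rightarrow> int"
  define tot where "tot a = delta (None, a) - (\<Sum>\<sigma>\<in>Pow S. delta (Some \<sigma>, a))" for a :: "'p luk"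
  define K where "K = (\<Union>\<sigma>\<in>Pow S. push \<sigma> ` insert (delta chi - delta \<^bold>\<top>) (constraints S \<sigma>)) \<union>
    (\<Union>a\<in>B. {tot a, - tot a})"
  have K: "finite K" using fin B by (simp add: K_def finite_constraints)
  have push: "lin J (push \<sigma> c) Y = lin S c (\<lambda>a. Y (Some \<sigma>, a))" if "\<sigma> \<subseteq> S" for \<sigma> c Y
  proof -
    have "lin J (push \<sigma> c) Y = lin ({Some \<sigma>} \<times> S) (push \<sigma> c) Y"
      using that J by (intro lin_mono_neutral) (auto simp: J_def X_def push_def split: if_splits)
    also have "\<dots> = lin S c (\<lambda>a. Y (Some \<sigma>, a))"
      unfolding lin_Pair by (auto simp: lin_def push_def intro!: sum.cong)
    finally show ?thesis .
  qed
  have tot: "lin J (tot a) Y = Y (None, a) - (\<Sum>\<sigma>\<in>Pow S. Y (Some \<sigma>, a))" if "a \<in> B" for a Y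
  proof -
    have "lin J (delta (Some \<sigma>, a)) Y = Y (Some \<sigma>, a)" if "\<sigma> \<in> Pow S" for \<sigma>
      using that \<open>a \<in> B\<close> B by (intro lin_delta J) (auto simp: J_def X_def)
    moreover have "lin J (delta (None, a)) Y = Y (None, a)"
      using \<open>a \<in> B\<close> by (intro lin_delta J) (auto simp: J_def)
    ultimately show ?thesis by (simp add: tot_def lin_minus lin_sum)
  qed
  from fourier_motzkin[OF J XJ K]
  obtain K' where K': "finite K'" "\<forall>c\<in>K'. \<forall>a\<in>X. c a = 0"
      "\<forall>V. K \<subseteq> V \<longrightarrow> (\<forall>a\<in>V. \<forall>b\<in>V. a + b \<in> V) \<longrightarrow> K' \<subseteq> V"
      "\<forall>y. (\<forall>c\<in>K'. lin J c y \<ge> 0) \<longrightarrow> (\<exists>z. (\<forall>i. i \<notin> X \<longrightarrow> z i = y i) \<and> (\<forall>c\<in>K. lin J c z \<ge> 0))"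
    by (elim exE conjE) (rule that)
  \<comment> \<open>The total at \<top> is 1 because it is the sum of the weights of a convex
    combination; the totals at the variables are the coordinates of y.\<close>
  define target where "target y = (\<lambda>a. case a of Var p \<Rightarrow> y p | _ \<Rightarrow> 1)" for y :: "'p \<Rightarrow> real"
  have lin_target: "lin J c Y = (\<Sum>p\<in>E. of_int (c (None, Var p)) * y p) + of_int (c (None, \<^bold>\<top>))"
    if "c \<in> K'" "\<And>a. a \<in> B \<Longrightarrow> Y (None, a) = target y a" for c y Y
  proof -
    have "lin J c Y = lin ({None} \<times> B) c Y"
      using that K'(2) J by (intro lin_mono_neutral) (auto simp: J_def)
    also have "\<dots> = (\<Sum>a\<in>B. of_int (c (None, a)) * target y a)"
      unfolding lin_Pair by (auto simp: lin_def that(2) intro!: sum.cong)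
    also have "\<dots> = (\<Sum>a\<in>Var ` E. of_int (c (None, a)) * target y a) + of_int (c (None, \<^bold>\<top>))"
      using E by (simp add: B_def target_def image_iff)
    also have "(\<Sum>a\<in>Var ` E. of_int (c (None, a)) * target y a) = (\<Sum>p\<in>E. of_int (c (None, Var p)) * y p)"
      by (simp add: sum.reindex inj_on_def target_def)
    finally show ?thesis .
  qed
  have "y \<in> Models E chi \<longleftrightarrow> (\<forall>c\<in>K'. (\<Sum>p\<in>E. of_int (c (None, Var p)) * y p) + of_int (c (None, \<^bold>\<top>)) \<ge> 0)"
    if y: "y \<in> cube E" for y
  proof
    assume "y \<in> Models E chi"
    then have chi1: "truth y chi = 1" by (simp add: Models_def)
    have ry: "range y \<subseteq> {0..1}" using y by (force simp: cube_def)
    then obtain \<sigma> where \<sigma>: "\<sigma> \<subseteq> S" "\<forall>c\<in>constraints S \<sigma>. lin S c (truth y) \<ge> 0"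
      using constraints_truth[OF _ fin cl] by blast
    \<comment> \<open>The copy of a region \<sigma> containing y takes all truth values, with weight
      1 at \<top>; every other copy is 0.\<close>
    define Z where "Z = (\<lambda>(s, a). case s of None \<Rightarrow> target y a
      | Some \<tau> \<Rightarrow> if \<tau> = \<sigma> then truth y a else 0)"
    have Z: "(\<lambda>a. Z (Some \<tau>, a)) = (if \<tau> = \<sigma> then truth y else (\<lambda>_. 0))" for \<tau>
      by (auto simp: Z_def)
    have "lin J (push \<tau> c) Z \<ge> 0"
      if "\<tau> \<subseteq> S" "c \<in> insert (delta chi - delta \<^bold>\<top>) (constraints S \<tau>)" for \<tau> c
    proof (cases "\<tau> = \<sigma>")
      case True
      then show ?thesis
        using that \<sigma> chi1 by (auto simp: push Z lin_minus lin_delta fin chiS TS)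
    next
      case False
      then show ?thesis using that by (simp add: push Z) (simp add: lin_def)
    qed
    moreover have "lin J (tot a) Z = 0" if "a \<in> B" for a
      using that \<sigma>(1) fin by (auto simp: tot Z_def sum.delta B_def target_def)
    ultimately have "K \<subseteq> {c. lin J c Z \<ge> 0}"
      by (auto simp: K_def lin_uminus)
    then have "K' \<subseteq> {c. lin J c Z \<ge> 0}"
      using K'(3) by (simp add: lin_plus)
    then show "\<forall>c\<in>K'. (\<Sum>p\<in>E. of_int (c (None, Var p)) * y p) + of_int (c (None, \<^bold>\<top>)) \<ge> 0"
      using lin_target[of _ Z y] by (auto simp: Z_def)
  next
    assume *: "\<forall>c\<in>K'. (\<Sum>p\<in>E. of_int (c (None, Var p)) * y p) + of_int (c (None, \<^bold>\<top>)) \<ge> 0"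
    define Y where "Y = (\<lambda>(s :: 'p luk set option, a). target y a)"
    have "\<forall>c\<in>K'. lin J c Y \<ge> 0" using * lin_target[of _ Y y] by (auto simp: Y_def)
    then obtain Z where ZY: "\<forall>i. i \<notin> X \<longrightarrow> Z i = Y i" and Z: "\<forall>c\<in>K. lin J c Z \<ge> 0"
      using K'(4) by blast
    define z where "z \<sigma> a = Z (Some \<sigma>, a)" for \<sigma> a
    have "lin S c (z \<sigma>) \<ge> 0" if "\<sigma> \<in> Pow S" "c \<in> insert (delta chi - delta \<^bold>\<top>) (constraints S \<sigma>)" for \<sigma> c
    proof -
      have "push \<sigma> c \<in> K" using that by (auto simp: K_def)
      then show ?thesis using Z push[of \<sigma> c Z] that(1) by (auto simp: z_def[abs_def])
    qed
    then have con: "\<forall>c\<in>constraints S \<sigma>. lin S c (z \<sigma>) \<ge> 0" "lin S (delta chi - delta \<^bold>\<top>) (z \<sigma>) \<ge> 0"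
      if "\<sigma> \<in> Pow S" for \<sigma>
      using that by auto
    have sum: "target y a = (\<Sum>\<sigma>\<in>Pow S. z \<sigma> a)" if "a \<in> B" for a
    proof -
      have "tot a \<in> K" "- tot a \<in> K" using that by (auto simp: K_def)
      then have "lin J (tot a) Z \<ge> 0" "lin J (- tot a) Z \<ge> 0" using Z by blast+
      then have "lin J (tot a) Z = 0" by (simp add: lin_uminus)
      moreover have "Z (None, a) = target y a" using ZY by (simp add: X_def Y_def image_iff)
      ultimately show ?thesis using that by (simp add: tot z_def)
    qed
    define w where "w \<sigma> p = (if p \<in> E then z \<sigma> (Var p) / z \<sigma> \<^bold>\<top> else 0)" for \<sigma> p
    \<comment> \<open>The copies of positive weight. The others vanish entirely, being squeezed
      between 0 and their weight 0.\<close>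
    define P where "P = {\<sigma> \<in> Pow S. z \<sigma> \<^bold>\<top> > 0}"
    have "finite P" using fin by (simp add: P_def)
    have nn: "0 \<le> z \<sigma> a" "z \<sigma> a \<le> z \<sigma> \<^bold>\<top>" if "\<sigma> \<in> Pow S" "a \<in> S" for \<sigma> a
      using constraints_solution(1,2)[OF fin cl con(1)] that by auto
    have P0: "z \<sigma> a = 0" if "\<sigma> \<in> Pow S - P" "a \<in> S" for \<sigma> a
      using nn[of \<sigma> a] that by (auto simp: P_def)
    have w: "w \<sigma> \<in> Models E chi" if "\<sigma> \<in> P" for \<sigma>
    proof -
      have \<sigma>: "\<sigma> \<in> Pow S" "z \<sigma> \<^bold>\<top> > 0" using that by (auto simp: P_def)
      have "w \<sigma> \<in> cube E"
        using nn \<sigma> by (auto simp: cube_def w_def VS)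
      moreover have "z \<sigma> chi = z \<sigma> \<^bold>\<top> * truth (w \<sigma>) chi"
        using \<sigma> by (intro constraints_solution(3)[OF fin cl con(1)] chiS) (auto simp: w_def VS)
      moreover have "z \<sigma> chi = z \<sigma> \<^bold>\<top>"
        using con(2)[OF \<sigma>(1)] nn(2)[OF \<sigma>(1) chiS] by (simp add: lin_minus lin_delta fin chiS TS)
      ultimately show ?thesis using \<sigma> by (simp add: Models_def)
    qed
    have restrict: "(\<Sum>\<sigma>\<in>Pow S. z \<sigma> a) = (\<Sum>\<sigma>\<in>P. z \<sigma> a)" if "a \<in> S" for a
      using P0 that fin by (intro sum.mono_neutral_right) (auto simp: P_def)
    have "(\<Sum>\<sigma>\<in>P. z \<sigma> \<^bold>\<top>) = 1"
      using sum[of "\<^bold>\<top>"] restrict[OF TS] by (simp add: B_def target_def)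
    \<comment> \<open>The only appeal to convexity: y is the combination of the normalised copies,
      all models of \<open>chi\<close>, with weights z \<sigma> \<top>.\<close>
    then have "(\<Sum>\<sigma>\<in>P. z \<sigma> \<^bold>\<top> *\<^sub>R w \<sigma>) \<in> Models E chi"
      by (intro convex_sum \<open>finite P\<close> conv w) (auto simp: P_def)
    moreover have "(\<Sum>\<sigma>\<in>P. z \<sigma> \<^bold>\<top> *\<^sub>R w \<sigma>) = y"
    proof
      fix p
      have "(\<Sum>\<sigma>\<in>P. z \<sigma> \<^bold>\<top> *\<^sub>R w \<sigma>) p = (\<Sum>\<sigma>\<in>P. z \<sigma> \<^bold>\<top> * w \<sigma> p)"
        by (simp add: sum_fun_apply scaleR_fun_def)
      also have "\<dots> = y p"
      proof (cases "p \<in> E")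
        case True
        then have "(\<Sum>\<sigma>\<in>P. z \<sigma> \<^bold>\<top> * w \<sigma> p) = (\<Sum>\<sigma>\<in>P. z \<sigma> (Var p))"
          by (intro sum.cong) (auto simp: w_def P_def)
        then show ?thesis
          using sum[of "Var p"] restrict[of "Var p"] True by (simp add: VS B_def target_def)
      next
        case False
        then show ?thesis using y by (simp add: w_def cube_def)
      qed
      finally show "(\<Sum>\<sigma>\<in>P. z \<sigma> \<^bold>\<top> *\<^sub>R w \<sigma>) p = y p" .
    qed
    ultimately show "y \<in> Models E chi" by simp
  qed
  then show ?thesis
    using K'(1) by (intro exI[of _ "(\<lambda>c. (\<lambda>p. c (None, Var p), c (None, \<^bold>\<top>))) ` K'"]) auto
qed

section \<open>Translating between the two calculi\<close>

definition fp_axioms :: "'v modal set" where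
  "fp_axioms = (\<Union>a b. {\<^bold>\<not>\<^sub>m Pr a \<^bold>\<leftrightarrow>\<^sub>m Pr (\<^bold>\<not> a), Pr (a \<^bold>\<rightarrow> b) \<^bold>\<rightarrow>\<^sub>m (Pr a \<^bold>\<rightarrow>\<^sub>m Pr b),
      Pr (a \<^bold>\<oplus> b) \<^bold>\<leftrightarrow>\<^sub>m ((Pr a \<^bold>\<rightarrow>\<^sub>m Pr (a \<^bold>\<odot> b)) \<^bold>\<rightarrow>\<^sub>m Pr b)}) \<union>
    Pr ` {a. {} \<turnstile>\<^sub>L a}"

lemma fp_axiom_neg: "\<^bold>\<not>\<^sub>m Pr a \<^bold>\<leftrightarrow>\<^sub>m Pr (\<^bold>\<not> a) \<in> fp_axioms"
  by (simp add: fp_axioms_def)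

lemma fp_axiom_imp: "Pr (a \<^bold>\<rightarrow> b) \<^bold>\<rightarrow>\<^sub>m (Pr a \<^bold>\<rightarrow>\<^sub>m Pr b) \<in> fp_axioms"
  unfolding fp_axioms_def by blast

lemma fp_axiom_oplus: "Pr (a \<^bold>\<oplus> b) \<^bold>\<leftrightarrow>\<^sub>m ((Pr a \<^bold>\<rightarrow>\<^sub>m Pr (a \<^bold>\<odot> b)) \<^bold>\<rightarrow>\<^sub>m Pr b) \<in> fp_axioms"
  unfolding fp_axioms_def by blast

lemma fp_axiom_N: "{} \<turnstile>\<^sub>L a \<Longrightarrow> Pr a \<in> fp_axioms"
  by (simp add: fp_axioms_def)

lemma fp_axiom_cases:
  assumes "A \<in> fp_axioms"
  obtains a where "A = (\<^bold>\<not>\<^sub>m Pr a \<^bold>\<leftrightarrow>\<^sub>m Pr (\<^bold>\<not> a))"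
  | a b where "A = (Pr (a \<^bold>\<rightarrow> b) \<^bold>\<rightarrow>\<^sub>m (Pr a \<^bold>\<rightarrow>\<^sub>m Pr b))"
  | a b where "A = (Pr (a \<^bold>\<oplus> b) \<^bold>\<leftrightarrow>\<^sub>m ((Pr a \<^bold>\<rightarrow>\<^sub>m Pr (a \<^bold>\<odot> b)) \<^bold>\<rightarrow>\<^sub>m Pr b))"
  | a where "{} \<turnstile>\<^sub>L a" "A = Pr a"
  using assms unfolding fp_axioms_def by blast

lemma fp_axiom_deriv: "A \<in> fp_axioms \<Longrightarrow> \<Gamma> \<turnstile>\<^sub>F\<^sub>P A"
  by (erule fp_axiom_cases) (simp_all add: fp_deriv.P1 fp_deriv.P2 fp_deriv.P3 fp_deriv.N)

text \<open>Modus ponens is the only rule with modal premises, so every instance of (P1)-(P3) and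
  every conclusion of necessitation can be treated as a premise of the propositional
  calculus.\<close>

lemma fp_to_luk: "\<Gamma> \<turnstile>\<^sub>F\<^sub>P A \<Longrightarrow> bullet ` (fp_axioms \<union> \<Gamma>) \<turnstile>\<^sub>L A\<^sup>\<bullet>"
proof (induction rule: fp_deriv.induct)
  case (prem A)
  then show ?case by (intro luk_deriv.prem) auto
next
  case (mp A B)
  then show ?case using luk_deriv.mp by (metis bullet.simps(3,4))
next
  case (P1 a)
  show ?case by (intro luk_deriv.prem imageI UnI1 fp_axiom_neg)
next
  case (P2 a b)
  show ?case by (intro luk_deriv.prem imageI UnI1 fp_axiom_imp)
next
  case (P3 a b)
  show ?case by (intro luk_deriv.prem imageI UnI1 fp_axiom_oplus)
next
  case (N a)
  then have "Pr a \<in> fp_axioms \<union> \<Gamma>" by (intro UnI1 fp_axiom_N)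
  then show ?case by (intro luk_deriv.prem imageI)
qed (simp_all only: bullet.simps, (rule luk_deriv.intros)+)

primrec unbullet :: "'v luk luk \<Rightarrow> 'v modal" where
  "unbullet (Var a) = Pr a"
| "unbullet \<^bold>\<bottom> = \<^bold>\<bottom>\<^sub>m"
| "unbullet (\<^bold>\<not> a) = \<^bold>\<not>\<^sub>m unbullet a"
| "unbullet (a \<^bold>\<oplus> b) = unbullet a \<^bold>\<oplus>\<^sub>m unbullet b"

lemma unbullet_bullet [simp]: "unbullet (A\<^sup>\<bullet>) = A"
  by (induction A) auto

lemma luk_to_fp:
  assumes "\<Delta> \<turnstile>\<^sub>L b" "\<And>c. c \<in> \<Delta> \<Longrightarrow> \<Gamma> \<turnstile>\<^sub>F\<^sub>P unbullet c"
  shows "\<Gamma> \<turnstile>\<^sub>F\<^sub>P unbullet b"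
  using assms(1)
proof (induction rule: luk_deriv.induct)
  case (mp a b)
  then show ?case using fp_deriv.mp by (metis unbullet.simps(3,4))
qed (use assms(2) in \<open>simp_all add: fp_deriv.intros del: fp_deriv.mp\<close>)

lemma vars_bullet: "vars (A\<^sup>\<bullet>) = events A"
  by (induction A) auto

section \<open>Integer inequalities between events\<close>

text \<open>The assignments to the variables \<open>p\<^sub>a\<close> which satisfy enough axioms of the probabilistic logic:
  eventuality means that finitely many axioms suffice.\<close>

definition fp_filter :: "('v luk \<Rightarrow> real) filter" where
  "fp_filter = (INF A\<in>fp_axioms. principal {w. range w \<subseteq> {0..1} \<and> truth w (A\<^sup>\<bullet>) = 1})"

lemma fp_filter_axiom:
  "A \<in> fp_axioms \<Longrightarrow> eventually (\<lambda>w. range w \<subseteq> {0..1} \<and> truth w (A\<^sup>\<bullet>) = 1) fp_filter"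
  unfolding fp_filter_def by (rule eventually_INF1) (auto simp: eventually_principal)

lemma eventually_fp_filter:
  assumes "eventually Q fp_filter"
  obtains X where "finite X" "X \<subseteq> fp_axioms"
    "\<forall>w. range w \<subseteq> {0..1} \<and> (\<forall>A\<in>X. truth w (A\<^sup>\<bullet>) = 1) \<longrightarrow> Q w"
proof -
  obtain X where X: "X \<subseteq> fp_axioms" "finite X"
    "eventually Q (INF A\<in>X. principal {w. range w \<subseteq> {0..1} \<and> truth w (A\<^sup>\<bullet>) = 1})"
    using assms unfolding fp_filter_def eventually_INF[of _ _ fp_axioms] by blast
  then have ev: "eventually Q (principal (\<Inter>A\<in>X. {w. range w \<subseteq> {0..1} \<and> truth w (A\<^sup>\<bullet>) = 1}))"
    by (simp add: INF_principal_finite)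
  show ?thesis
  proof (rule that[OF X(2,1)], intro allI impI)
    fix w :: "'a luk \<Rightarrow> real"
    assume "range w \<subseteq> {0..1} \<and> (\<forall>A\<in>X. truth w (A\<^sup>\<bullet>) = 1)"
    then have "w \<in> (\<Inter>A\<in>X. {w. range w \<subseteq> {0..1} \<and> truth w (A\<^sup>\<bullet>) = 1})" by simp
    then show "Q w" using ev unfolding eventually_principal by (rule bspec[rotated])
  qed
qed

lemma truth_MIff:
  assumes "range w \<subseteq> {0..1}"
  shows "truth w ((A \<^bold>\<leftrightarrow>\<^sub>m B)\<^sup>\<bullet>) = 1 \<longleftrightarrow> truth w (A\<^sup>\<bullet>) = truth w (B\<^sup>\<bullet>)"
  using truth_range[OF assms, of "A\<^sup>\<bullet>"] truth_range[OF assms, of "B\<^sup>\<bullet>"]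
  by (auto simp: min_def)

lemma range_unit: "range w \<subseteq> {0..1} \<longleftrightarrow> (\<forall>a. 0 \<le> w a \<and> w a \<le> (1::real))"
  by (auto simp: image_subset_iff)

text \<open>The bounds are built into every generator of the filter, so any axiom yields
  them.\<close>

lemma fp_range: "eventually (\<lambda>w. \<forall>a. 0 \<le> w a \<and> w a \<le> 1) fp_filter"
  using fp_filter_axiom[OF fp_axiom_neg] by (rule eventually_mono) (auto simp: range_unit)

lemma fp_theorem: "{} \<turnstile>\<^sub>L a \<Longrightarrow> eventually (\<lambda>w. w a = 1) fp_filter"
  using fp_filter_axiom[OF fp_axiom_N] by (rule eventually_mono) auto

lemma fp_neg: "eventually (\<lambda>w. w (\<^bold>\<not> a) = 1 - w a) fp_filter"
  using fp_filter_axiom[OF fp_axiom_neg[of a]]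
  by (rule eventually_mono) (auto simp only: truth_MIff bullet.simps truth_simps)

lemma fp_imp: "eventually (\<lambda>w. w a + w (a \<^bold>\<rightarrow> b) - 1 \<le> w b) fp_filter"
  using fp_filter_axiom[OF fp_axiom_imp[of a b]] fp_range
proof eventually_elim
  case (elim w)
  then have "w (a \<^bold>\<rightarrow> b) \<le> 1" by blast
  then show ?case using elim(1) by (auto simp: min_def split: if_splits)
qed

lemma fp_le: "{} \<turnstile>\<^sub>L a \<^bold>\<rightarrow> b \<Longrightarrow> eventually (\<lambda>w. w a \<le> w b) fp_filter"
proof -
  assume "{} \<turnstile>\<^sub>L a \<^bold>\<rightarrow> b"
  from fp_theorem[OF this] fp_imp[of a b] show ?thesis by eventually_elim simp
qed

lemma luk_valid: "(\<And>v. range v \<subseteq> {0..1} \<Longrightarrow> truth v a = 1) \<Longrightarrow> {} \<turnstile>\<^sub>L a"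
  by (rule luk_complete) auto

text \<open>(P3) is this equation up to two truncations. The inner one is harmless because a \<odot>
  b implies a, the outer one because a -> (b -> a \<odot> b) gives w a + w b - 1 \<le> w (a \<odot>
  b).\<close>

lemma fp_oplus: "eventually (\<lambda>w. w (a \<^bold>\<oplus> b) + w (a \<^bold>\<odot> b) = w a + w b) fp_filter"
proof -
  have le: "0 \<le> truth v a" "truth v a \<le> 1" "truth v b \<le> 1" if "range v \<subseteq> {0..1}" for v
    using truth_range[OF that] by auto
  have 1: "{} \<turnstile>\<^sub>L a \<^bold>\<odot> b \<^bold>\<rightarrow> a"
    by (rule luk_valid) (use le in \<open>auto simp: min_def\<close>)
  have 2: "{} \<turnstile>\<^sub>L a \<^bold>\<rightarrow> (b \<^bold>\<rightarrow> a \<^bold>\<odot> b)"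
    by (rule luk_valid) (use le in \<open>auto simp: min_def\<close>)
  show ?thesis
    using fp_le[OF 1] fp_le[OF 2] fp_imp[of b "a \<^bold>\<odot> b"] fp_range
      fp_filter_axiom[OF fp_axiom_oplus[of a b]]
  proof eventually_elim
    case (elim w)
    then have "truth w ((Pr (a \<^bold>\<oplus> b))\<^sup>\<bullet>) = truth w (((Pr a \<^bold>\<rightarrow>\<^sub>m Pr (a \<^bold>\<odot> b)) \<^bold>\<rightarrow>\<^sub>m Pr b)\<^sup>\<bullet>)"
      using truth_MIff by blast
    then have "w (a \<^bold>\<oplus> b) = min 1 (1 - min 1 (1 - w a + w (a \<^bold>\<odot> b)) + w b)" by simp
    then show ?case using elim(1-3) by (simp add: min_def split: if_splits)
  qed
qed

text \<open>\<open>normal gs\<close> is a good sequence: its truth values are the digits \<open>1, \<dots>, 1, r, 0, \<dots>, 0\<close> of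
  the sum of those of \<open>gs\<close>. It is obtained by steps that replace \<open>a\<close>, \<open>b\<close> by \<open>a \<oplus> b\<close>, \<open>a \<odot> b\<close>, which
  preserve the sum of the probabilities by (P3).\<close>

primrec carry_in :: "'v luk \<Rightarrow> 'v luk list \<Rightarrow> 'v luk list" where
  "carry_in g [] = [g]"
| "carry_in g (a # as) = (g \<^bold>\<oplus> a) # carry_in (g \<^bold>\<odot> a) as"

primrec normal :: "'v luk list \<Rightarrow> 'v luk list" where
  "normal [] = []"
| "normal (g # gs) = carry_in g (normal gs)"

lemma fp_carry_in:
  "eventually (\<lambda>w. sum_list (map w (carry_in g as)) = w g + sum_list (map w as)) fp_filter"
proof (induction as arbitrary: g)
  case (Cons a as)
  show ?case using fp_oplus[of g a] Cons[of "g \<^bold>\<odot> a"] by eventually_elim simp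
qed simp

lemma fp_normal: "eventually (\<lambda>w. sum_list (map w (normal gs)) = sum_list (map w gs)) fp_filter"
proof (induction gs)
  case (Cons g gs)
  show ?case using fp_carry_in[of g "normal gs"] Cons by eventually_elim simp
qed simp

lemma length_carry_in: "length (carry_in g as) = Suc (length as)"
  by (induction as arbitrary: g) auto

lemma length_normal: "length (normal gs) = length gs"
  by (induction gs) (auto simp: length_carry_in)

text \<open>Here s is the sum encoded by the digits of \<open>as\<close>. Adding g tops up the first
  digit that is not full and carries the excess on. The result is one digit longer, so i may equal
  the length of \<open>as\<close>.\<close>

lemma truth_carry_in:
  fixes s :: real
  assumes "range v \<subseteq> {0..1}" "0 \<le> s" "s \<le> length as"
    "\<And>i. i < length as \<Longrightarrow> truth v (as ! i) = min 1 (max 0 (s - i))" "i \<le> length as"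
  shows "truth v (carry_in g as ! i) = min 1 (max 0 (s + truth v g - i))"
  using assms(2-)
proof (induction as arbitrary: g s i)
  case Nil
  then show ?case using truth_range[OF assms(1)] by simp
next
  case (Cons a as)
  have a: "truth v a = min 1 s" using Cons.prems(1) Cons.prems(3)[of 0] by simp
  have g: "0 \<le> truth v g" "truth v g \<le> 1" using truth_range[OF assms(1)] by auto
  show ?case
  proof (cases i)
    case 0
    then show ?thesis using a g Cons.prems(1) by (auto simp: min_def max_def)
  next
    case (Suc j)
    \<comment> \<open>Removing the leading digit min 1 s leaves digits that encode max 0 (s -
      1).\<close>
    have "truth v (carry_in (g \<^bold>\<odot> a) as ! j) =
      min 1 (max 0 (max 0 (s - 1) + truth v (g \<^bold>\<odot> a) - j))"
    proof (rule Cons.IH)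
      show "truth v (as ! k) = min 1 (max 0 (max 0 (s - 1) - k))" if "k < length as" for k
        using Cons.prems(3)[of "Suc k"] that by (auto simp: min_def max_def)
    qed (use Cons.prems Suc in auto)
    then show ?thesis using a g Cons.prems(1) Suc by (auto simp: min_def max_def)
  qed
qed

lemma truth_normal:
  assumes "range v \<subseteq> {0..1}"
  shows "i < length gs \<Longrightarrow> truth v (normal gs ! i) = min 1 (max 0 (sum_list (map (truth v) gs) - i))"
    and "0 \<le> sum_list (map (truth v) gs)" "sum_list (map (truth v) gs) \<le> length gs"
proof (induction gs arbitrary: i)
  case (Cons g gs)
  {
    case 1
    then show ?case
      using Cons.IH truth_carry_in[OF assms, of "sum_list (map (truth v) gs)" "normal gs" i g]
      by (simp add: length_normal add.commute)
  next
    case 2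
    then show ?case using Cons.IH truth_range[OF assms, of g] by simp
  next
    case 3
    then show ?case using Cons.IH truth_range[OF assms, of g] by simp
  }
qed auto

lemma fp_sum_list_ge:
  fixes gs :: "'v luk list"
  assumes "\<And>v. range v \<subseteq> {0..1} \<Longrightarrow> real d \<le> sum_list (map (truth v) gs)"
  shows "eventually (\<lambda>w. real d \<le> sum_list (map w gs)) fp_filter"
proof -
  \<comment> \<open>Ensures that the first d digits exist; testing the hypothesis at one valuation
    suffices.\<close>
  have d: "d \<le> length gs"
    using assms[of "\<lambda>_. 0"] truth_normal(3)[of "\<lambda>_. 0" gs] by simp
  have "{} \<turnstile>\<^sub>L normal gs ! i" if "i < d" for i
  proof (rule luk_valid)
    fix v :: "'v \<Rightarrow> real" assume v: "range v \<subseteq> {0..1}"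
    then show "truth v (normal gs ! i) = 1"
      using assms[OF v] truth_normal(1)[OF v, of i gs] that d by simp
  qed
  then have "eventually (\<lambda>w. \<forall>i\<in>{..<d}. w (normal gs ! i) = 1) fp_filter"
    by (intro eventually_ball_finite) (auto intro: fp_theorem)
  then show ?thesis
    using fp_normal[of gs] fp_range
  proof eventually_elim
    case (elim w)
    have "real d = (\<Sum>i<d. w (normal gs ! i))" using elim(1) by simp
    also have "\<dots> \<le> (\<Sum>i<length gs. w (normal gs ! i))"
      using d elim(3) by (intro sum_mono2) auto
    also have "\<dots> = sum_list (map w (normal gs))"
      by (simp add: sum_list_sum_nth length_normal atLeast0LessThan)
    finally show ?case using elim(2) by simp
  qed
qed

lemma fp_linear:
  fixes c :: "'v luk \<Rightarrow> int" and k :: int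
  assumes E: "finite E"
    and "\<And>v. range v \<subseteq> {0..1} \<Longrightarrow> (\<Sum>p\<in>E. of_int (c p) * truth v p) + of_int k \<ge> 0"
  shows "eventually (\<lambda>w. (\<Sum>p\<in>E. of_int (c p) * w p) + of_int k \<ge> 0) fp_filter"
proof -
  \<comment> \<open>A coefficient -n of p becomes n copies of the negation of p, because n (1 - f p)
    = -n f p + n; the constants n add up to m.\<close>
  define l where "l p = (if c p \<ge> 0 then replicate (nat (c p)) p else replicate (nat (- c p)) (\<^bold>\<not> p))" for p
  define m where "m = (\<Sum>p\<in>E. max 0 (- c p))"
  obtain es where es: "set es = E" "distinct es" using finite_distinct_list[OF E] by blast
  define gs where "gs = concat (map l es)"
  have gs: "sum_list (map f gs) = (\<Sum>p\<in>E. of_int (c p) * f p) + of_int m"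
    if "\<And>p. p \<in> E \<Longrightarrow> f (\<^bold>\<not> p) = 1 - f p" for f :: "'v luk \<Rightarrow> real"
  proof -
    have "sum_list (map f gs) = sum_list (map (\<lambda>p. sum_list (map f (l p))) es)"
      unfolding gs_def by (induction es) auto
    also have "\<dots> = (\<Sum>p\<in>E. sum_list (map f (l p)))"
      using es by (simp add: sum_list_distinct_conv_sum_set)
    also have "\<dots> = (\<Sum>p\<in>E. of_int (c p) * f p + of_int (max 0 (- c p)))"
    proof (intro sum.cong refl)
      fix p assume "p \<in> E"
      then show "sum_list (map f (l p)) = of_int (c p) * f p + of_int (max 0 (- c p))"
        by (cases "c p \<ge> 0") (simp_all add: l_def sum_list_replicate that right_diff_distrib)
    qed
    finally show ?thesis by (simp add: sum.distrib m_def)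
  qed
  \<comment> \<open>The bound m - k may be negative; \<open>nat\<close> then replaces it by 0, still
    a lower bound because truth values are non-negative.\<close>
  have "eventually (\<lambda>w. real (nat (m - k)) \<le> sum_list (map w gs)) fp_filter"
  proof (rule fp_sum_list_ge)
    fix v :: "'v \<Rightarrow> real" assume v: "range v \<subseteq> {0..1}"
    then show "real (nat (m - k)) \<le> sum_list (map (truth v) gs)"
      using assms(2)[OF v] gs[of "truth v"] truth_normal(2)[OF v, of gs] by simp
  qed
  moreover have "eventually (\<lambda>w. \<forall>p\<in>E. w (\<^bold>\<not> p) = 1 - w p) fp_filter"
    using E by (intro eventually_ball_finite) (auto intro: fp_neg)
  ultimately show ?thesis
  proof eventually_elim
    case (elim w)
    then show ?case using gs[of w] by simp
  qed
qed

section \<open>Coherent assignments extend to states\<close>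

lemma closed_fun_compact:
  fixes S :: "('a \<Rightarrow> real) set"
  assumes "compact S"
  shows "closed S"
proof -
  have "Hausdorff_space (euclidean :: ('a \<Rightarrow> real) topology)"
    unfolding euclidean_product_topology[symmetric] by (simp add: Hausdorff_space_product_topology)
  then show ?thesis
    using compactin_imp_closedin[of euclidean S] assms by simp
qed

lemma compact_unit_functions: "compact {w :: 'a \<Rightarrow> real. range w \<subseteq> {0..1}}"
proof -
  have "{w :: 'a \<Rightarrow> real. range w \<subseteq> {0..1}} = PiE UNIV (\<lambda>_. {0..1})"
    by (auto simp: PiE_UNIV_domain image_subset_iff)
  moreover have "compactin (euclidean :: ('a \<Rightarrow> real) topology) (PiE UNIV (\<lambda>_. {0..1}))"
    unfolding euclidean_product_topology[symmetric] by (simp add: compactin_PiE)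
  ultimately show ?thesis by simp
qed

text \<open>Forming u x + v y is continuous in the pair (x, y), and the closure of S \<times> S is
  the product of the closures.\<close>

lemma convex_closure_fun:
  fixes S :: "('a \<Rightarrow> real) set"
  assumes "convex S"
  shows "convex (closure S)"
proof (rule convexI)
  fix x y :: "'a \<Rightarrow> real" and u v :: real
  assume xy: "x \<in> closure S" "y \<in> closure S" and uv: "0 \<le> u" "0 \<le> v" "u + v = 1"
  define f where "f = (\<lambda>(x :: 'a \<Rightarrow> real, y) a. u * x a + v * y a)"
  have "continuous_on UNIV f"
    unfolding f_def case_prod_unfold
    by (intro continuous_on_coordinatewise_then_product continuous_intros
        continuous_on_product_then_coordinatewise[OF continuous_on_fst[OF continuous_on_id]]
        continuous_on_product_then_coordinatewise[OF continuous_on_snd[OF continuous_on_id]])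
  then have "f ` closure (S \<times> S) \<subseteq> closure S"
  proof (intro image_closure_subset closed_closure)
    have "f p \<in> S" if "p \<in> S \<times> S" for p
      using that convexD[OF assms, of "fst p" "snd p" u v] uv
      by (auto simp: f_def scaleR_fun_def plus_fun_def)
    then show "f ` (S \<times> S) \<subseteq> closure S" using closure_subset by blast
  qed (auto intro: continuous_on_subset)
  then have "f (x, y) \<in> closure S" using xy by (auto simp: closure_Times)
  then show "u *\<^sub>R x + v *\<^sub>R y \<in> closure S"
    by (simp add: f_def scaleR_fun_def plus_fun_def)
qed

lemma convex_coherent: "convex (coherent E)"
  unfolding coherent_def by (intro convex_closure_fun convex_convex_hull)

text \<open>Linear conditions replace the truncated connectives of (P1)-(P3): linearity makes the
  set convex, and non-strict inequalities and equations make it closed.\<close>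

definition states :: "('v luk \<Rightarrow> real) set" where
  "states = {w. range w \<subseteq> {0..1} \<and> (\<forall>a. {} \<turnstile>\<^sub>L a \<longrightarrow> w a = 1) \<and> (\<forall>a. w (\<^bold>\<not> a) = 1 - w a) \<and>
    (\<forall>a b. w a + w (a \<^bold>\<rightarrow> b) - 1 \<le> w b) \<and> (\<forall>a b. w (a \<^bold>\<oplus> b) + w (a \<^bold>\<odot> b) = w a + w b)}"

lemma truth_state: "range x \<subseteq> {0..1} \<Longrightarrow> truth x \<in> states"
  using truth_range[of x] truth_sound[of "{}" _ x]
  by (auto simp: states_def image_subset_iff min_def)

lemma convex_states: "convex states"
proof (rule convexI)
  fix x y :: "'v luk \<Rightarrow> real" and u v :: real
  assume x: "x \<in> states" and y: "y \<in> states" and uv: "0 \<le> u" "0 \<le> v" "u + v = 1"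
  have v: "v = 1 - u" using uv by simp
  have "u * x a + v * y a \<in> {0..1}" for a
    using x y uv convex_bound_le[of "x a" 1 "y a" u v] by (auto simp: states_def range_unit)
  moreover have "u * x a + v * y a = 1" if "{} \<turnstile>\<^sub>L a" for a
    using x y uv that by (simp add: states_def)
  moreover have "u * x (\<^bold>\<not> a) + v * y (\<^bold>\<not> a) = 1 - (u * x a + v * y a)" for a
  proof -
    have neg: "x (\<^bold>\<not> a) = 1 - x a" "y (\<^bold>\<not> a) = 1 - y a" using x y by (auto simp: states_def)
    show ?thesis unfolding neg v by (simp add: algebra_simps)
  qed
  moreover have "(u * x a + v * y a) + (u * x (a \<^bold>\<rightarrow> b) + v * y (a \<^bold>\<rightarrow> b)) - 1 \<le> u * x b + v * y b" for a b
  proof -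
    have "u * (x a + x (a \<^bold>\<rightarrow> b) - 1) + v * (y a + y (a \<^bold>\<rightarrow> b) - 1) \<le> u * x b + v * y b"
      using x y uv by (intro add_mono mult_left_mono) (auto simp: states_def)
    then show ?thesis by (simp add: v algebra_simps)
  qed
  moreover have "(u * x (a \<^bold>\<oplus> b) + v * y (a \<^bold>\<oplus> b)) + (u * x (a \<^bold>\<odot> b) + v * y (a \<^bold>\<odot> b)) =
      (u * x a + v * y a) + (u * x b + v * y b)" for a b
  proof -
    have "x (a \<^bold>\<oplus> b) + x (a \<^bold>\<odot> b) = x a + x b" "y (a \<^bold>\<oplus> b) + y (a \<^bold>\<odot> b) = y a + y b"
      using x y unfolding states_def by blast+
    then have "u * (x (a \<^bold>\<oplus> b) + x (a \<^bold>\<odot> b)) + v * (y (a \<^bold>\<oplus> b) + y (a \<^bold>\<odot> b)) = u * (x a + x b) + v * (y a + y b)"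
      by (simp only:)
    then show ?thesis by (simp add: algebra_simps)
  qed
  ultimately have "(\<lambda>a. u * x a + v * y a) \<in> states"
    unfolding states_def by blast
  then show "u *\<^sub>R x + v *\<^sub>R y \<in> states"
    by (simp add: scaleR_fun_def plus_fun_def)
qed

lemma compact_states: "compact (states :: ('v luk \<Rightarrow> real) set)"
proof -
  let ?U = "{w :: 'v luk \<Rightarrow> real. range w \<subseteq> {0..1}}"
  let ?C = "{w :: 'v luk \<Rightarrow> real. (\<forall>a. {} \<turnstile>\<^sub>L a \<longrightarrow> w a = 1) \<and> (\<forall>a. w (\<^bold>\<not> a) = 1 - w a) \<and>
    (\<forall>a b. w a + w (a \<^bold>\<rightarrow> b) - 1 \<le> w b) \<and> (\<forall>a b. w (a \<^bold>\<oplus> b) + w (a \<^bold>\<odot> b) = w a + w b)}"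
  have "closed ?C"
    by (intro closed_Collect_conj closed_Collect_all closed_Collect_imp open_Collect_const
        closed_Collect_eq closed_Collect_le continuous_intros continuous_on_product_coordinates)
  then have "compact (?U \<inter> ?C)"
    by (intro compact_Int_closed compact_unit_functions)
  moreover have "?U \<inter> ?C = states" by (auto simp: states_def)
  ultimately show ?thesis by simp
qed

lemma state_fp_axiom:
  assumes "w \<in> states" "A \<in> fp_axioms"
  shows "truth w (A\<^sup>\<bullet>) = 1"
proof -
  have w: "range w \<subseteq> {0..1}" "\<And>a. {} \<turnstile>\<^sub>L a \<Longrightarrow> w a = 1" "\<And>a. w (\<^bold>\<not> a) = 1 - w a"
    "\<And>a b. w a + w (a \<^bold>\<rightarrow> b) - 1 \<le> w b" "\<And>a b. w (a \<^bold>\<oplus> b) + w (a \<^bold>\<odot> b) = w a + w b"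
    using assms(1) by (auto simp: states_def)
  have r: "0 \<le> w a" "w a \<le> 1" for a using w(1) by (auto simp: range_unit)
  show ?thesis
    using assms(2)
  proof (cases rule: fp_axiom_cases)
    case (1 a)
    show ?thesis unfolding 1 truth_MIff[OF w(1)] using w(3) by simp
  next
    case (2 a b)
    show ?thesis using w(4)[of a b] r by (simp add: 2 min_def)
  next
    case (3 a b)
    have "{} \<turnstile>\<^sub>L a \<^bold>\<odot> b \<^bold>\<rightarrow> a"
    proof (rule luk_valid)
      fix v :: "'a \<Rightarrow> real" assume v: "range v \<subseteq> {0..1}"
      show "truth v (a \<^bold>\<odot> b \<^bold>\<rightarrow> a) = 1"
        using truth_range[OF v, of a] truth_range[OF v, of b] by (auto simp: min_def)
    qed
    then have "w (a \<^bold>\<odot> b) \<le> w a" using w(2) w(4)[of "a \<^bold>\<odot> b" a] by simp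
    moreover have "w (a \<^bold>\<oplus> b) = w a + w b - w (a \<^bold>\<odot> b)" using w(5)[of a b] by simp
    ultimately show ?thesis
      unfolding 3 truth_MIff[OF w(1)] using r[of "a \<^bold>\<oplus> b"] r[of a] by (simp add: min_def)
  next
    case (4 a)
    then show ?thesis using w(2) by simp
  qed
qed

text \<open>Restriction to E is linear and continuous, so the restricted states form a convex
  compact, hence closed, set. It contains the truth vectors and therefore their closed convex
  hull.\<close>

lemma coherent_extends_to_state:
  fixes E :: "'v luk set"
  assumes "y \<in> coherent E"
  obtains w where "w \<in> states" "y = (\<lambda>a. if a \<in> E then w a else 0)"
proof -
  define \<pi> :: "('v luk \<Rightarrow> real) \<Rightarrow> 'v luk \<Rightarrow> real" where "\<pi> w = (\<lambda>a. if a \<in> E then w a else 0)" for w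
  have "continuous_on states \<pi>"
    unfolding \<pi>_def
  proof (rule continuous_on_coordinatewise_then_product)
    fix a
    show "continuous_on states (\<lambda>w. if a \<in> E then w a else 0)"
      by (cases "a \<in> E") (auto intro: continuous_on_subset[OF continuous_on_product_coordinates])
  qed
  then have "closed (\<pi> ` states)"
    by (intro closed_fun_compact compact_continuous_image compact_states)
  moreover have "convex (\<pi> ` states)"
  proof (rule convex_linear_image)
    show "linear \<pi>" by (rule linearI) (auto simp: \<pi>_def scaleR_fun_def)
  qed (rule convex_states)
  moreover have "{(\<lambda>a. if a \<in> E then truth x a else 0) | x :: 'v \<Rightarrow> real. range x \<subseteq> {0..1}} \<subseteq> \<pi> ` states"
    using truth_state by (auto simp: \<pi>_def)
  ultimately have "coherent E \<subseteq> \<pi> ` states"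
    unfolding coherent_def by (intro closure_minimal hull_minimal)
  then show ?thesis using assms that by (auto simp: \<pi>_def)
qed

lemma restrict_coherent:
  "range x \<subseteq> {0..1} \<Longrightarrow> (\<lambda>a. if a \<in> E then truth x a else 0) \<in> coherent E"
  unfolding coherent_def by (rule subsetD[OF closure_subset]) (auto intro!: hull_inc)

section \<open>Countable algebras of reals\<close>

instance luk :: (countable) countable
  by countable_datatype

text \<open>The truth values generated by finitely many reals form a countable algebra, which can be
  copied into any infinite type.\<close>

lemma embed_valuation:
  fixes v :: "'p \<Rightarrow> real"
  assumes "infinite (UNIV :: 'a set)" "range v \<subseteq> {0..1}" "finite (range v)"
  obtains M :: "'a set" and add neg zero and g :: "real \<Rightarrow> 'a" where "mv_algebra M add neg zero" "range (g \<circ> v) \<subseteq> M"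
    "\<And>a b. mv_eval add neg zero (g \<circ> v) a = mv_eval add neg zero (g \<circ> v) b \<longleftrightarrow> truth v a = truth v b"
proof -
  \<comment> \<open>The variable type may be uncountable, so the values of v are renamed by natural
    numbers: formulas over these are countable, and so is R.\<close>
  define e where "e = from_nat_into (range v)"
  have e: "range e = range v"
    unfolding e_def by (rule range_from_nat_into) (use assms(3) in \<open>auto intro: countable_finite\<close>)
  define R where "R = range (truth e)"
  have Rv: "v p \<in> R" for p
  proof -
    obtain n where "v p = e n" using e by (metis imageE rangeI)
    then show ?thesis
      unfolding R_def by (intro range_eqI[of _ _ "Var n"]) simp
  qed
  have R01: "R \<subseteq> {0..1}" using truth_range[of e] e assms(2) by (auto simp: R_def)
  have R0: "0 \<in> R"
    unfolding R_def by (rule range_eqI[of _ _ "\<^bold>\<bottom>"]) simp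
  have Rneg: "std_neg x \<in> R" if "x \<in> R" for x
  proof -
    obtain a where "x = truth e a" using \<open>x \<in> R\<close> by (auto simp: R_def)
    then show ?thesis
      unfolding R_def by (intro range_eqI[of _ _ "\<^bold>\<not> a"]) (simp add: std_neg_def)
  qed
  have Radd: "std_add x y \<in> R" if "x \<in> R" "y \<in> R" for x y
  proof -
    obtain a b where "x = truth e a" "y = truth e b" using \<open>x \<in> R\<close> \<open>y \<in> R\<close> by (auto simp: R_def)
    then show ?thesis
      unfolding R_def by (intro range_eqI[of _ _ "a \<^bold>\<oplus> b"]) (simp add: std_add_def)
  qed
  obtain f :: "nat \<Rightarrow> 'a" where f: "inj f"
    using infinite_countable_subset[OF assms(1)] by blast
  have "countable R" unfolding R_def by simp
  define g where "g = f \<circ> to_nat_on R"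
  have g: "inj_on g R"
    unfolding g_def using f \<open>countable R\<close> by (intro comp_inj_on inj_on_to_nat_on) (auto intro: inj_on_subset)
  define h where "h = inv_into R g"
  have hg: "h (g x) = x" if "x \<in> R" for x using that g by (simp add: h_def)
  define add where "add x y = g (std_add (h x) (h y))" for x y
  define neg where "neg x = g (std_neg (h x))" for x
  interpret std: mv_algebra "{0..1}" std_add std_neg 0 by (rule mv_algebra_std)
  have alg: "mv_algebra (g ` R) add neg (g 0)"
  proof
    fix x y assume "x \<in> g ` R" "y \<in> g ` R"
    then obtain a b where ab: "x = g a" "y = g b" "a \<in> R" "b \<in> R" by auto
    show "add x y \<in> g ` R" using ab by (simp add: add_def hg Radd)
    show "add x y = add y x" using ab R01 by (simp add: add_def hg std.add_comm subset_iff)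
    show "add (neg (add (neg x) y)) y = add (neg (add (neg y) x)) x"
      using ab R01 std.mv[of a b] by (simp add: add_def neg_def hg Radd Rneg subset_iff)
  next
    fix x y z assume "x \<in> g ` R" "y \<in> g ` R" "z \<in> g ` R"
    then obtain a b c where ab: "x = g a" "y = g b" "z = g c" "a \<in> R" "b \<in> R" "c \<in> R" by auto
    show "add (add x y) z = add x (add y z)"
      using ab R01 std.add_assoc[of a b c] by (simp add: add_def hg Radd subset_iff)
  next
    fix x assume "x \<in> g ` R"
    then obtain a where a: "x = g a" "a \<in> R" by auto
    show "neg x \<in> g ` R" using a by (simp add: neg_def hg Rneg)
    show "add x (g 0) = x" "neg (neg x) = x" "add x (neg (g 0)) = neg (g 0)"
      using a R0 R01 std.add_zero[of a] std.neg_neg[of a] std.add_neg_zero[of a]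
      by (simp_all add: add_def neg_def hg Rneg subset_iff)
  qed (use R0 in simp)
  have "mv_eval add neg (g 0) (g \<circ> v) a = g (truth v a) \<and> truth v a \<in> R" for a
  proof (induction a)
    case (Neg a)
    then show ?case using Rneg[of "truth v a"] by (simp add: neg_def hg std_neg_def)
  next
    case (Oplus a b)
    then show ?case using Radd[of "truth v a" "truth v b"] by (simp add: add_def hg std_add_def)
  qed (use Rv R0 in simp_all)
  moreover have "range (g \<circ> v) \<subseteq> g ` R" using Rv by auto
  ultimately show ?thesis
    using that[OF alg, of "g"] g by (simp add: inj_on_eq_iff)
qed

text \<open>Condition (3) is the hub: it is equivalent to (1) and to (2) separately, and (2) implies
  (4), which leads back to (3).\<close>

theorem theorem4p3:
  fixes \<Phi> \<Psi> :: "'v modal" and E :: "'v luk set" and chi :: "'v luk luk"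
  assumes E: "E = events \<Phi> \<union> events \<Psi>"
    and chi_vars: "vars chi \<subseteq> E"
    and chi_Mod: "Models E chi = coherent E"
    and universe: "infinite (UNIV :: 'a set)"
  shows "({\<Phi>} \<turnstile>\<^sub>F\<^sub>P \<Psi> \<longleftrightarrow> {chi, \<Phi>\<^sup>\<bullet>} \<turnstile>\<^sub>L \<Psi>\<^sup>\<bullet>)
    \<and> ({chi, \<Phi>\<^sup>\<bullet>} \<turnstile>\<^sub>L \<Psi>\<^sup>\<bullet> \<longleftrightarrow> coherent E \<inter> Models E (\<Phi>\<^sup>\<bullet>) \<subseteq> Models E (\<Psi>\<^sup>\<bullet>))
    \<and> (coherent E \<inter> Models E (\<Phi>\<^sup>\<bullet>) \<subseteq> Models E (\<Psi>\<^sup>\<bullet>) \<longleftrightarrow>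
        (\<forall>(M :: 'a set) add neg zero. mv_algebra M add neg zero \<longrightarrow>
          (\<forall>v. range v \<subseteq> M \<longrightarrow>
            mv_eval add neg zero v chi = mv_eval add neg zero v \<^bold>\<top> \<longrightarrow>
            mv_eval add neg zero v (\<Phi>\<^sup>\<bullet>) = mv_eval add neg zero v \<^bold>\<top> \<longrightarrow>
            mv_eval add neg zero v (\<Psi>\<^sup>\<bullet>) = mv_eval add neg zero v \<^bold>\<top>)))"
    (is "(?fp \<longleftrightarrow> ?luk) \<and> (?luk \<longleftrightarrow> ?sub) \<and> (?sub \<longleftrightarrow> ?alg)")
proof -
  have finE: "finite E"
  proof -
    have "finite (events A)" for A :: "'v modal" by (induction A) auto
    then show ?thesis by (simp add: E)
  qed
  have vars: "vars (\<Phi>\<^sup>\<bullet>) \<subseteq> E" "vars (\<Psi>\<^sup>\<bullet>) \<subseteq> E" by (auto simp: vars_bullet E)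
  \<comment> \<open>Points of the cube vanish outside E, whereas completeness concerns valuations of
    all variables; on formulas over E the two agree.\<close>
  have cut: "truth (\<lambda>a. if a \<in> E then w a else 0) c = truth w c" if "vars c \<subseteq> E" for w c
    using that by (intro truth_cong) auto
  have cut_cube: "(\<lambda>a. if a \<in> E then w a else 0) \<in> cube E" if "range w \<subseteq> {0..1}" for w
    using that by (auto simp: cube_def image_subset_iff)
  have cube: "range y \<subseteq> {0..1}" "finite (range y)" if "y \<in> cube E" for y
  proof -
    show "range y \<subseteq> {0..1}" using that by (force simp: cube_def)
    have "range y \<subseteq> insert 0 (y ` E)" using that by (auto simp: cube_def)
    then show "finite (range y)" using finE finite_subset by blast
  qed
  have "?sub" if ?fp
  proof
    fix y assume "y \<in> coherent E \<inter> Models E (\<Phi>\<^sup>\<bullet>)"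
    then have y: "y \<in> coherent E" "y \<in> cube E" "truth y (\<Phi>\<^sup>\<bullet>) = 1" by (auto simp: Models_def)
    \<comment> \<open>The derivation may use axioms about events outside E, which y, being 0 there,
      need not satisfy; the state w satisfies all of them and agrees with y on E.\<close>
    then obtain w where w: "w \<in> states" "y = (\<lambda>a. if a \<in> E then w a else 0)"
      using coherent_extends_to_state by blast
    have "truth w (\<Psi>\<^sup>\<bullet>) = 1"
    proof (rule truth_sound[OF fp_to_luk[OF \<open>?fp\<close>]])
      show "range w \<subseteq> {0..1}" using w(1) by (simp add: states_def)
      show "truth w c = 1" if "c \<in> bullet ` (fp_axioms \<union> {\<Phi>})" for c
        using that state_fp_axiom[OF w(1)] y(3) cut[OF vars(1)] w(2) by auto
    qed
    then show "y \<in> Models E (\<Psi>\<^sup>\<bullet>)" using y(2) cut[OF vars(2)] w(2) by (simp add: Models_def)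
  qed
  moreover have "?fp" if ?sub
  proof -
    obtain K :: "(('v luk \<Rightarrow> int) \<times> int) set" where K: "finite K"
      "\<forall>y\<in>cube E. y \<in> coherent E \<longleftrightarrow> (\<forall>(c, k)\<in>K. (\<Sum>p\<in>E. of_int (c p) * y p) + of_int k \<ge> 0)"
      using convex_models_hrep[OF finE chi_vars] convex_coherent[of E] unfolding chi_Mod by blast
    have "eventually (\<lambda>w. (\<Sum>p\<in>E. of_int (fst q p) * w p) + of_int (snd q) \<ge> 0) fp_filter"
      if q: "q \<in> K" for q
    proof (rule fp_linear[OF finE])
      fix x :: "'v \<Rightarrow> real" assume x: "range x \<subseteq> {0..1}"
      let ?y = "\<lambda>a. if a \<in> E then truth x a else 0"
      have "?y \<in> coherent E" "?y \<in> cube E"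
        using restrict_coherent[OF x] cut_cube[of "truth x"] truth_range[OF x]
        by (simp_all add: range_unit)
      then have "(\<Sum>p\<in>E. of_int (fst q p) * ?y p) + of_int (snd q) \<ge> 0" using K(2) q by fastforce
      then show "(\<Sum>p\<in>E. of_int (fst q p) * truth x p) + of_int (snd q) \<ge> 0" by simp
    qed
    then have "eventually (\<lambda>w. \<forall>q\<in>K. (\<Sum>p\<in>E. of_int (fst q p) * w p) + of_int (snd q) \<ge> 0) fp_filter"
      by (intro eventually_ball_finite K(1)) blast
    then obtain X where X: "finite X" "X \<subseteq> fp_axioms" and
      XK: "\<forall>w. range w \<subseteq> {0..1} \<and> (\<forall>A\<in>X. truth w (A\<^sup>\<bullet>) = 1) \<longrightarrow>
        (\<forall>q\<in>K. (\<Sum>p\<in>E. of_int (fst q p) * w p) + of_int (snd q) \<ge> 0)"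
      by (rule eventually_fp_filter)
    \<comment> \<open>Finitely many premises, as completeness over the reals requires. A valuation
      satisfying the axioms in X has a coherent restriction to E, where the hypothesis
      applies.\<close>
    have "bullet ` insert \<Phi> X \<turnstile>\<^sub>L \<Psi>\<^sup>\<bullet>"
    proof (rule luk_complete)
      fix w :: "'v luk \<Rightarrow> real"
      assume w: "range w \<subseteq> {0..1}" and wX: "\<And>c. c \<in> bullet ` insert \<Phi> X \<Longrightarrow> truth w c = 1"
      let ?y = "\<lambda>a. if a \<in> E then w a else 0"
      have "\<forall>q\<in>K. (\<Sum>p\<in>E. of_int (fst q p) * w p) + of_int (snd q) \<ge> 0"
        using XK w wX by simp
      then have "\<forall>(c, k)\<in>K. (\<Sum>p\<in>E. of_int (c p) * ?y p) + of_int k \<ge> 0"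
        by (auto simp: case_prod_beta)
      then have "?y \<in> coherent E" using K(2) cut_cube[OF w] by blast
      moreover have "?y \<in> Models E (\<Phi>\<^sup>\<bullet>)"
        using cut_cube[OF w] cut[OF vars(1)] wX by (simp add: Models_def)
      ultimately have "?y \<in> Models E (\<Psi>\<^sup>\<bullet>)" using that by blast
      then show "truth w (\<Psi>\<^sup>\<bullet>) = 1" using cut[OF vars(2)] by (simp add: Models_def)
    qed (use X in simp)
    then have "{\<Phi>} \<turnstile>\<^sub>F\<^sub>P unbullet (\<Psi>\<^sup>\<bullet>)"
      by (rule luk_to_fp) (auto intro: fp_deriv.prem fp_axiom_deriv[OF subsetD[OF X(2)]])
    then show ?thesis by simp
  qed
  moreover have "?luk" if ?sub
  proof (rule luk_complete)
    fix w :: "'v luk \<Rightarrow> real"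
    assume w: "range w \<subseteq> {0..1}" and "\<And>c. c \<in> {chi, \<Phi>\<^sup>\<bullet>} \<Longrightarrow> truth w c = 1"
    then have "(\<lambda>a. if a \<in> E then w a else 0) \<in> Models E chi \<inter> Models E (\<Phi>\<^sup>\<bullet>)"
      using cut_cube[OF w] cut[OF vars(1)] cut[OF chi_vars] by (simp add: Models_def)
    then show "truth w (\<Psi>\<^sup>\<bullet>) = 1"
      using that cut[OF vars(2)] unfolding chi_Mod by (auto simp: Models_def)
  qed simp
  moreover have "?alg" if ?luk
  proof (intro allI impI)
    fix M :: "'a set" and add neg zero and v :: "'v luk \<Rightarrow> 'a"
    assume "mv_algebra M add neg zero" and v: "range v \<subseteq> M"
      and *: "mv_eval add neg zero v chi = mv_eval add neg zero v \<^bold>\<top>"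
        "mv_eval add neg zero v (\<Phi>\<^sup>\<bullet>) = mv_eval add neg zero v \<^bold>\<top>"
    then interpret mv_algebra M add neg zero by simp
    show "mv_eval add neg zero v (\<Psi>\<^sup>\<bullet>) = mv_eval add neg zero v \<^bold>\<top>"
      using luk_sound[OF that v] * by auto
  qed
  moreover have "?sub" if ?luk
  proof
    fix y assume y: "y \<in> coherent E \<inter> Models E (\<Phi>\<^sup>\<bullet>)"
    then have "y \<in> Models E chi" "y \<in> Models E (\<Phi>\<^sup>\<bullet>)" by (auto simp: chi_Mod)
    then show "y \<in> Models E (\<Psi>\<^sup>\<bullet>)"
      using truth_sound[OF that, of y] cube by (auto simp: Models_def)
  qed
  moreover have "?sub" if ?alg
  proof
    fix y assume "y \<in> coherent E \<inter> Models E (\<Phi>\<^sup>\<bullet>)"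
    then have y: "y \<in> cube E" "truth y chi = 1" "truth y (\<Phi>\<^sup>\<bullet>) = 1"
      by (auto simp: chi_Mod[symmetric] Models_def)
    \<comment> \<open>Since y vanishes outside the finite set E, it takes finitely many values, and
      the whole evaluation can be carried out in the given infinite type.\<close>
    obtain M :: "'a set" and add neg zero g where M: "mv_algebra M add neg zero" "range (g \<circ> y) \<subseteq> M"
      and eq: "\<And>a b. mv_eval add neg zero (g \<circ> y) a = mv_eval add neg zero (g \<circ> y) b \<longleftrightarrow> truth y a = truth y b"
      using embed_valuation[OF universe cube[OF y(1)]] by blast
    have "mv_eval add neg zero (g \<circ> y) (\<Psi>\<^sup>\<bullet>) = mv_eval add neg zero (g \<circ> y) \<^bold>\<top>"
      by (rule that[rule_format, OF M]) (simp_all add: eq y del: mv_eval.simps)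
    then show "y \<in> Models E (\<Psi>\<^sup>\<bullet>)" using y(1) by (simp only: eq) (simp add: Models_def)
  qed
  ultimately show ?thesis by blast
qed

end
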